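(* Let $\lambda$ be a measurable cardinal, let $\theta$ be a regular cardinal such that $V_{\lambda+2} \subseteq H(\theta)$, and let $\leq^{*}$ be a wellordering of $H(\theta)$. Then for every countable ordinal $\beta$ and every countable $X \prec (H(\theta), \in, \leq^{*})$, there is $z \in [\lambda]^{\beta}$ such that $$[z]^{<\omega} \subseteq \bigcap \{ D^{Z}_{\lambda} : Z \prec (H(\theta), \in, \leq^{*}),\ Z \in X\}$$ and such that, letting $Y = Sk_{(H(\theta), \in, \leq^{*})}(X \cup z)$, $X \cap \lambda$ is a proper initial segment of $Y \cap \lambda$.
   Context: $Sk_{(H(\theta),\in,\leq^{*})}(W)$ denotes the Skolem hull of $W$ in $(H(\theta),\in,\leq^{*})$. For a countable elementary submodel $Z$ and an ordinal $\eta$ (here $\eta=\lambda$), $D^{Z}_{\eta}$ is the set of all $a \in [\eta]^{<\omega}$ such that $f(a) \in Z$ for every $f \colon [\eta]^{|a|} \to \omega_{1}$ with $f \in Z$; in the intersection, $Z$ ranges over countable elementary submodels. $[\lambda]^\beta$ denotes the subsets of $\lambda$ of ordertype $\beta$.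
   Formalization: The formal theorem additionally assumes that β is nonzero (for β = 0, Y = X and the initial segment is not proper) and that λ ∈ X (without it the claim can fail, e.g. for λ the δ-th measurable with δ = X ∩ ω₁). *)

theory Defs
  imports Main "HOL-Library.Countable_Set" "HOL-Library.Equipollence"
begin

section \<open>The set-theoretic universe\<close>

text \<open>
  A type of sets satisfying second-order ZFC, with \<open>elts\<close> sending a set to the HOL set of its
  elements. Pairing follows from infinity, power set and replacement; choice is inherited
  from HOL. As replacement ranges over all HOL functions, HOL-level notions (countability,
  equipollence, arbitrary subsets of a set) agree with their counterparts inside the universe.
\<close>

class zfc_universe =
  fixes elts :: "'a \<Rightarrow> 'a set"
  assumes extensionality: "elts x = elts y \<Longrightarrow> x = y"
    and foundation: "wf {(x, y). x \<in> elts y}"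
    and separation: "S \<subseteq> elts x \<Longrightarrow> S \<in> range elts"
    and union: "(\<Union>y \<in> elts x. elts y) \<in> range elts"
    and power_set: "{y. elts y \<subseteq> elts x} \<in> range elts"
    and replacement: "f ` elts x \<in> range elts"
    and infinity: "\<exists>w. (\<exists>e \<in> elts w. elts e = {}) \<and>
                       (\<forall>x \<in> elts w. \<exists>y \<in> elts w. elts y = insert x (elts x))"

text \<open>The set with the given elements; meaningful only if these do form a set.\<close>

definition vset :: "'v::zfc_universe set \<Rightarrow> 'v" where
  "vset S = (THE x. elts x = S)"

definition vpair :: "'v::zfc_universe \<Rightarrow> 'v \<Rightarrow> 'v" where
  "vpair a b = vset {vset {a}, vset {a, b}}"

definition vfun :: "'v::zfc_universe \<Rightarrow> 'v set \<Rightarrow> 'v set \<Rightarrow> bool" where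
  "vfun f A B \<longleftrightarrow> elts f \<subseteq> {vpair a b |a b. a \<in> A \<and> b \<in> B} \<and>
                 (\<forall>a \<in> A. \<exists>!b. vpair a b \<in> elts f)"

definition vapp :: "'v::zfc_universe \<Rightarrow> 'v \<Rightarrow> 'v" where
  "vapp f a = (THE b. vpair a b \<in> elts f)"

section \<open>Ordinals and cardinals\<close>

definition transitive_set :: "'v::zfc_universe \<Rightarrow> bool" where
  "transitive_set x \<longleftrightarrow> (\<forall>y \<in> elts x. elts y \<subseteq> elts x)"

definition Ord :: "'v::zfc_universe \<Rightarrow> bool" where
  "Ord \<alpha> \<longleftrightarrow> transitive_set \<alpha> \<and> (\<forall>y \<in> elts \<alpha>. transitive_set y)"

definition ord_succ :: "'v::zfc_universe \<Rightarrow> 'v" where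
  "ord_succ \<alpha> = vset (insert \<alpha> (elts \<alpha>))"

definition omega1 :: "'v::zfc_universe set" where
  "omega1 = {\<alpha>. Ord \<alpha> \<and> countable (elts \<alpha>)}"

definition Card :: "'v::zfc_universe \<Rightarrow> bool" where
  "Card \<kappa> \<longleftrightarrow> Ord \<kappa> \<and> (\<forall>\<alpha> \<in> elts \<kappa>. elts \<alpha> \<prec> elts \<kappa>)"

definition regular_cardinal :: "'v::zfc_universe \<Rightarrow> bool" where
  "regular_cardinal \<kappa> \<longleftrightarrow> Card \<kappa> \<and> infinite (elts \<kappa>) \<and>
     (\<forall>\<alpha> \<in> elts \<kappa>. \<forall>g. g ` elts \<alpha> \<subseteq> elts \<kappa> \<longrightarrow> (\<exists>\<gamma> \<in> elts \<kappa>. g ` elts \<alpha> \<subseteq> elts \<gamma>))"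

definition ultrafilter_on :: "'a set \<Rightarrow> 'a set set \<Rightarrow> bool" where
  "ultrafilter_on S U \<longleftrightarrow> U \<subseteq> Pow S \<and> S \<in> U \<and> {} \<notin> U \<and>
     (\<forall>A \<in> U. \<forall>B. A \<subseteq> B \<and> B \<subseteq> S \<longrightarrow> B \<in> U) \<and>
     (\<forall>A \<in> U. \<forall>B \<in> U. A \<inter> B \<in> U) \<and>
     (\<forall>A. A \<subseteq> S \<longrightarrow> A \<in> U \<or> S - A \<in> U)"

definition measurable_cardinal :: "'v::zfc_universe \<Rightarrow> bool" where
  "measurable_cardinal \<kappa> \<longleftrightarrow> Card \<kappa> \<and> uncountable (elts \<kappa>) \<and>
     (\<exists>U. ultrafilter_on (elts \<kappa>) U \<and>
          (\<forall>\<xi> \<in> elts \<kappa>. {\<xi>} \<notin> U) \<and>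
          (\<forall>F. F \<subseteq> U \<and> F \<noteq> {} \<and> F \<prec> elts \<kappa> \<longrightarrow> \<Inter>F \<in> U))"

section \<open>The cumulative hierarchy and hereditarily small sets\<close>

function V_stage :: "'v::zfc_universe \<Rightarrow> 'v set" where
  "V_stage \<alpha> = {x. \<exists>\<gamma> \<in> elts \<alpha>. elts x \<subseteq> V_stage \<gamma>}"
  by auto
termination
  by (relation "{(x, y). x \<in> elts y}") (auto simp: foundation)

declare V_stage.simps [simp del]

text \<open>The elements of the transitive closure of \<open>x\<close>.\<close>

definition trcl :: "'v::zfc_universe \<Rightarrow> 'v set" where
  "trcl x = {y. (y, x) \<in> {(u, v). u \<in> elts v}\<^sup>+}"

definition H :: "'v::zfc_universe \<Rightarrow> 'v set" where
  "H \<theta> = {x. trcl x \<prec> elts \<theta>}"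

section \<open>First-order logic over \<open>(M, \<in>, \<le>*)\<close>\<close>

datatype fm = Mem nat nat | Le nat nat | Eq nat nat | Neg fm | Conj fm fm | All nat fm

primrec fvars :: "fm \<Rightarrow> nat set" where
  "fvars (Mem i j) = {i, j}"
| "fvars (Le i j) = {i, j}"
| "fvars (Eq i j) = {i, j}"
| "fvars (Neg \<phi>) = fvars \<phi>"
| "fvars (Conj \<phi> \<psi>) = fvars \<phi> \<union> fvars \<psi>"
| "fvars (All i \<phi>) = fvars \<phi> - {i}"

primrec sat :: "'v::zfc_universe set \<Rightarrow> ('v \<times> 'v) set \<Rightarrow> (nat \<Rightarrow> 'v) \<Rightarrow> fm \<Rightarrow> bool" where
  "sat M R s (Mem i j) \<longleftrightarrow> s i \<in> elts (s j)"
| "sat M R s (Le i j) \<longleftrightarrow> (s i, s j) \<in> R"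
| "sat M R s (Eq i j) \<longleftrightarrow> s i = s j"
| "sat M R s (Neg \<phi>) \<longleftrightarrow> \<not> sat M R s \<phi>"
| "sat M R s (Conj \<phi> \<psi>) \<longleftrightarrow> sat M R s \<phi> \<and> sat M R s \<psi>"
| "sat M R s (All i \<phi>) \<longleftrightarrow> (\<forall>x \<in> M. sat M R (s(i := x)) \<phi>)"

definition elem_submodel :: "'v::zfc_universe set \<Rightarrow> 'v set \<Rightarrow> ('v \<times> 'v) set \<Rightarrow> bool" where
  "elem_submodel N M R \<longleftrightarrow> N \<noteq> {} \<and> N \<subseteq> M \<and>
     (\<forall>\<phi> s. range s \<subseteq> N \<longrightarrow> (sat N R s \<phi> \<longleftrightarrow> sat M R s \<phi>))"

text \<open>
  Closure of \<open>W\<close> under the canonical Skolem functions of \<open>(M, \<in>, R)\<close>: the one for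
  \<open>\<exists>v\<^sub>i. \<phi>\<close> picks the \<open>R\<close>-least witness whenever there is a witness. Only the parameters that
  occur free need to be in the hull already, so parameter-free formulas also contribute
  when \<open>W\<close> is empty.
\<close>

inductive_set Skolem_hull :: "'v::zfc_universe set \<Rightarrow> ('v \<times> 'v) set \<Rightarrow> 'v set \<Rightarrow> 'v set"
  for M :: "'v set" and R :: "('v \<times> 'v) set" and W :: "'v set" where
  base: "x \<in> W \<Longrightarrow> x \<in> Skolem_hull M R W"
| witness: "\<lbrakk>\<forall>j \<in> fvars \<phi> - {i}. s j \<in> Skolem_hull M R W;
             x \<in> M; sat M R (s(i := x)) \<phi>;
             \<forall>y \<in> M. sat M R (s(i := y)) \<phi> \<longrightarrow> (x, y) \<in> R\<rbrakk>
            \<Longrightarrow> x \<in> Skolem_hull M R W"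

section \<open>Subsets of ordinals and the sets \<open>D\<close>\<close>

definition n_subsets :: "'v::zfc_universe \<Rightarrow> nat \<Rightarrow> 'v set" where
  "n_subsets \<eta> n = {a. elts a \<subseteq> elts \<eta> \<and> finite (elts a) \<and> card (elts a) = n}"

definition fin_subsets :: "'v::zfc_universe \<Rightarrow> 'v set" where
  "fin_subsets \<eta> = {a. elts a \<subseteq> elts \<eta> \<and> finite (elts a)}"

text \<open>The subsets of \<open>\<eta>\<close> of order type \<open>\<beta>\<close>; \<open>g\<close> is the increasing enumeration.\<close>

definition otype_subsets :: "'v::zfc_universe \<Rightarrow> 'v \<Rightarrow> 'v set" where
  "otype_subsets \<eta> \<beta> = {z. elts z \<subseteq> elts \<eta> \<and>
     (\<exists>g. bij_betw g (elts \<beta>) (elts z) \<and>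
          (\<forall>\<xi> \<in> elts \<beta>. \<forall>\<zeta> \<in> elts \<beta>. \<xi> \<in> elts \<zeta> \<longleftrightarrow> g \<xi> \<in> elts (g \<zeta>)))}"

definition D_set :: "'v::zfc_universe \<Rightarrow> 'v \<Rightarrow> 'v set" where
  "D_set \<eta> Z = {a \<in> fin_subsets \<eta>.
     \<forall>f \<in> elts Z. vfun f (n_subsets \<eta> (card (elts a))) omega1 \<longrightarrow> vapp f a \<in> elts Z}"

text \<open>For sets of ordinals, which are ordered by membership.\<close>

definition proper_initial_segment :: "'v::zfc_universe set \<Rightarrow> 'v set \<Rightarrow> bool" where
  "proper_initial_segment A B \<longleftrightarrow> A \<subset> B \<and> (\<forall>x \<in> A. \<forall>y \<in> B. y \<in> elts x \<longrightarrow> y \<in> A)"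

end

(*
  Let mu be the <=*-least nonprincipal lambda-complete ultrafilter on lambda, so mu lies in every
  definably closed N containing lambda. Call c generic over N if c belongs to every set in N and mu.
  A K-definable partition of a set in mu into fewer than lambda pieces has exactly one piece in mu, and
  its index is in K; hence adding a generic c to K adds no new ordinal below an element of K.
  Choose c_a, for a < beta, generic over the hull of X, of all countable elementary Z in X, and of the
  earlier c_b. Adding finitely many c_a one at a time to X, respectively to Z, shows
  that Y end-extends X below lambda, and that f(a) is in Z when the range of f is bounded by an
  ordinal of Z below lambda. Such a bound exists because omega_1 < lambda.
*)
theory Submission
  imports Defs "HOL-Library.Countable"
begin

section \<open>Sets and ordinals\<close>

text \<open>The partition behind end extension comes from a description of hulls: an element of the
  hull of \<open>K\<close> and \<open>c\<close> is the value at \<open>c\<close> of a function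
  definable over \<open>K\<close>. If that value lies below \<open>x\<close> in \<open>K\<close>,
  the fibres over the elements of \<open>x\<close> are the pieces, and the index of the large fibre
  is the value itself. That \<open>M\<close> contains two stages above \<open>lam\<close> puts every
  subset of \<open>lam\<close>, every relation on \<open>lam\<close> and a measure into
  \<open>M\<close>. So completeness can be stated first-order, which makes the least measure
  definable from \<open>lam\<close>, and it still covers arbitrary HOL families. Elementary
  submodels and hulls are treated alike through closure under definable elements
  (\<open>def_closed\<close>). One sequence can serve \<open>X\<close> and all \<open>Z\<close>
  because genericity passes to subsets, and because the hulls involved are countable while countably
  many large sets have a common element. Adding finitely many ordinals is enough, since an element
  of a hull depends on finitely many parameters.\<close>

lemma mem_irrefl: "x \<notin> elts (x :: 'v::zfc_universe)"
  using wf_irrefl[OF foundation] by force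

lemma mem_asym: "x \<in> elts y \<Longrightarrow> (y :: 'v::zfc_universe) \<notin> elts x"
  using wf_asym[OF foundation] by force

lemma mem_induct:
  assumes "\<And>x :: 'v::zfc_universe. (\<And>y. y \<in> elts x \<Longrightarrow> P y) \<Longrightarrow> P x"
  shows "P x"
  using wf_induct_rule[OF foundation, of P] assms by simp

lemma elts_vset: "S \<in> range elts \<Longrightarrow> elts (vset S :: 'v::zfc_universe) = S"
  unfolding vset_def by (rule theI') (auto intro: extensionality)

lemma elts_vset_subset: "S \<subseteq> elts (x :: 'v::zfc_universe) \<Longrightarrow> elts (vset S :: 'v) = S"
  by (rule elts_vset[OF separation])

lemma elts_vset_image: "elts (vset (f ` elts (x :: 'v::zfc_universe)) :: 'v) = f ` elts x"
  by (rule elts_vset[OF replacement])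

lemma vset_elts [simp]: "vset (elts x) = (x :: 'v::zfc_universe)"
  by (rule extensionality) (simp add: elts_vset)

text \<open>Pairing out of replacement: infinity supplies a set containing the empty set and its
  successor; sending the former to \<open>a\<close> and everything else to \<open>b\<close> has
  range \<open>{a, b}\<close>.\<close>

lemma elts_vset_doubleton: "elts (vset {a, b} :: 'v::zfc_universe) = {a, b}"
proof -
  obtain w e :: 'v where w: "e \<in> elts w" "elts e = {}"
    "\<forall>x \<in> elts w. \<exists>y \<in> elts w. elts y = insert x (elts x)"
    using infinity by blast
  then obtain y where y: "y \<in> elts w" "y \<noteq> e" by fastforce
  have "(\<lambda>x. if x = e then a else b) ` elts w = {a, b}"
    using w(1) y by auto
  then show ?thesis by (metis elts_vset replacement)
qed

lemma elts_vset_singleton: "elts (vset {a} :: 'v::zfc_universe) = {a}"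
  using elts_vset_doubleton[of a a] by simp

lemma elts_vpair: "elts (vpair a b :: 'v::zfc_universe) = {vset {a}, vset {a, b}}"
  unfolding vpair_def by (rule elts_vset_doubleton)

lemma vpair_eq_iff: "vpair a b = vpair c d \<longleftrightarrow> a = c \<and> b = (d :: 'v::zfc_universe)"
proof
  assume "vpair a b = vpair c d"
  then have "{vset {a}, vset {a, b}} = {vset {c}, vset {c, d}}"
    by (metis elts_vpair)
  then have "(elts ` {vset {a}, vset {a, b}}) = (elts ` {vset {c}, vset {c, d}} :: 'v set set)"
    by simp
  then show "a = c \<and> b = d"
    by (auto simp: elts_vset_doubleton elts_vset_singleton doubleton_eq_iff)
qed simp

lemma eq_vset_singleton_iff: "z = vset {a} \<longleftrightarrow> elts z = {a :: 'v::zfc_universe}"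
  by (metis elts_vset_singleton vset_elts)

lemma eq_vset_doubleton_iff: "z = vset {a, b} \<longleftrightarrow> elts z = {a, b :: 'v::zfc_universe}"
  by (metis elts_vset_doubleton vset_elts)

lemma eq_vpair_iff: "z = vpair a b \<longleftrightarrow> elts z = {vset {a}, vset {a, b :: 'v::zfc_universe}}"
  by (metis elts_vpair vset_elts)

lemma vapp_eqI: "vfun f A B \<Longrightarrow> a \<in> A \<Longrightarrow> vpair a (vapp f a) \<in> elts f"
  unfolding vfun_def vapp_def by (metis (no_types, lifting) theI')

lemma vfun_pairD:
  assumes "vfun f A B" and "vpair a b \<in> elts f"
  shows "a \<in> A" "b \<in> B"
  using assms unfolding vfun_def by (force simp: vpair_eq_iff)+

lemma Ord_mem: "Ord a \<Longrightarrow> x \<in> elts a \<Longrightarrow> Ord x"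
  unfolding Ord_def transitive_set_def by blast

lemma Ord_subset: "Ord a \<Longrightarrow> x \<in> elts a \<Longrightarrow> elts x \<subseteq> elts a"
  unfolding Ord_def transitive_set_def by blast

lemma Ord_linear: "Ord a \<Longrightarrow> Ord b \<Longrightarrow> a \<in> elts b \<or> a = b \<or> b \<in> elts a"
proof (induction a arbitrary: b rule: mem_induct)
  case (1 a)
  note IHa = 1
  show ?case using IHa(3)
  proof (induction b rule: mem_induct)
    case (1 b)
    have a: "y \<in> elts b \<or> y = b \<or> b \<in> elts y" if "y \<in> elts a" for y
      using IHa(1)[OF that] Ord_mem[OF IHa(2) that] 1(2) by blast
    have b: "a \<in> elts x \<or> a = x \<or> x \<in> elts a" if "x \<in> elts b" for x
      using 1(1)[OF that] Ord_mem[OF 1(2) that] by blast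
    show ?case
    proof (rule ccontr)
      assume n: "\<not> ?thesis"
      have "elts a \<subseteq> elts b" using a n Ord_subset[OF IHa(2)] by blast
      moreover have "elts b \<subseteq> elts a" using b n Ord_subset[OF 1(2)] by blast
      ultimately show False using n extensionality by blast
    qed
  qed
qed

lemma finite_Ord_max:
  assumes "finite F" and "F \<noteq> {}" and "\<And>x. x \<in> F \<Longrightarrow> Ord x"
  shows "\<exists>m \<in> F. \<forall>x \<in> F. x = m \<or> x \<in> elts m"
  using assms
proof (induction rule: finite_ne_induct)
  case (insert x F)
  then obtain m where m: "m \<in> F" "\<forall>y \<in> F. y = m \<or> y \<in> elts m" by auto
  with insert.prems Ord_linear[of x m] consider "x \<in> elts m" | "x = m" | "m \<in> elts x" by auto
  then show ?case
  proof cases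
    case 3
    then have "\<forall>y \<in> insert x F. y = x \<or> y \<in> elts x"
      using m Ord_subset[OF insert.prems[of x] 3] by auto
    then show ?thesis by blast
  qed (use m in auto)
qed auto

section \<open>Formulas and definable predicates\<close>

instance fm :: countable
  by countable_datatype

lemma finite_fvars: "finite (fvars \<phi>)"
  by (induction \<phi>) auto

lemma sat_cong: "(\<And>j. j \<in> fvars \<phi> \<Longrightarrow> s j = t j) \<Longrightarrow> sat M R s \<phi> \<longleftrightarrow> sat M R t \<phi>"
proof (induction \<phi> arbitrary: s t)
  case (All i \<phi>)
  have "sat M R (s(i := x)) \<phi> \<longleftrightarrow> sat M R (t(i := x)) \<phi>" for x
    by (rule All.IH) (use All.prems in auto)
  then show ?case by simp
next
  case (Conj \<phi> \<psi>)
  have "sat M R s \<phi> \<longleftrightarrow> sat M R t \<phi>" "sat M R s \<psi> \<longleftrightarrow> sat M R t \<psi>"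
    by (auto intro!: Conj.IH Conj.prems)
  then show ?case by simp
next
  case (Neg \<phi>)
  then show ?case by (metis fvars.simps(4) sat.simps(4))
qed auto

text \<open>\<open>f\<close> need not be injective: the renaming serves both to separate the
  variables of two formulas and to identify variables.\<close>

lemma sat_rename: "\<exists>\<psi>. \<forall>s. sat M R s \<psi> \<longleftrightarrow> sat M R (\<lambda>n. s (f n)) \<phi>"
proof (induction \<phi> arbitrary: f)
  case (Mem i j)
  show ?case by (rule exI[of _ "Mem (f i) (f j)"]) simp
next
  case (Le i j)
  show ?case by (rule exI[of _ "Le (f i) (f j)"]) simp
next
  case (Eq i j)
  show ?case by (rule exI[of _ "Eq (f i) (f j)"]) simp
next
  case (Neg \<phi>)
  obtain \<psi> where "\<forall>s. sat M R s \<psi> \<longleftrightarrow> sat M R (\<lambda>n. s (f n)) \<phi>" using Neg by blast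
  then show ?case by (intro exI[of _ "Neg \<psi>"]) simp
next
  case (Conj \<phi>1 \<phi>2)
  obtain \<psi>1 \<psi>2 where "\<forall>s. sat M R s \<psi>1 \<longleftrightarrow> sat M R (\<lambda>n. s (f n)) \<phi>1"
    "\<forall>s. sat M R s \<psi>2 \<longleftrightarrow> sat M R (\<lambda>n. s (f n)) \<phi>2" using Conj by metis
  then show ?case by (intro exI[of _ "Conj \<psi>1 \<psi>2"]) simp
next
  case (All i \<phi>)
  \<comment> \<open>The bound variable moves to a \<open>k\<close> that is not the image of a free
    variable, which prevents capture.\<close>
  obtain k where k: "k \<notin> f ` fvars \<phi>"
    using finite_fvars ex_new_if_finite[OF infinite_UNIV_nat] by blast
  obtain \<psi> where \<psi>: "\<forall>s. sat M R s \<psi> \<longleftrightarrow> sat M R (\<lambda>n. s ((f(i := k)) n)) \<phi>"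
    using All by blast
  have "sat M R (\<lambda>n. (s(k := x)) ((f(i := k)) n)) \<phi> \<longleftrightarrow> sat M R ((\<lambda>n. s (f n))(i := x)) \<phi>" for s x
    by (rule sat_cong) (use k in auto)
  then show ?case using \<psi> by (intro exI[of _ "All k \<psi>"]) simp
qed

definition term_over :: "'v set \<Rightarrow> ((nat \<Rightarrow> 'v) \<Rightarrow> 'v) \<Rightarrow> bool" where
  "term_over N e \<longleftrightarrow> (\<exists>i. e = (\<lambda>s. s i)) \<or> (\<exists>p \<in> N. e = (\<lambda>s. p))"

lemma term_over_var: "term_over N (\<lambda>s. s i)"
  by (auto simp: term_over_def)

lemma term_over_param: "p \<in> N \<Longrightarrow> term_over N (\<lambda>s. p)"
  by (auto simp: term_over_def)

locale wo_structure =
  fixes M :: "'v::zfc_universe set" and R :: "('v \<times> 'v) set"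
  assumes transitive: "x \<in> M \<Longrightarrow> y \<in> elts x \<Longrightarrow> y \<in> M"
    and well_order: "well_order_on M R"
begin

text \<open>
  Predicates on assignments are used as a shallow embedding of formulas with parameters;
  the rule for quantifiers treats assignments in de Bruijn style.
\<close>

definition definable :: "'v set \<Rightarrow> ((nat \<Rightarrow> 'v) \<Rightarrow> bool) \<Rightarrow> bool" where
  "definable N P \<longleftrightarrow> (\<exists>\<phi> e. (\<forall>n. term_over N (e n)) \<and>
     (\<forall>s. range s \<subseteq> M \<longrightarrow> (P s \<longleftrightarrow> sat M R (\<lambda>n. e n s) \<phi>)))"

lemma definable_sat:
  assumes "\<And>n. term_over N (\<lambda>s. e s n)"
  shows "definable N (\<lambda>s. sat M R (e s) \<phi>)"
  unfolding definable_def
  by (intro exI[of _ \<phi>] exI[of _ "\<lambda>n s. e s n"]) (simp add: assms)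

lemma definable_mem:
  assumes "term_over N e1" and "term_over N e2"
  shows "definable N (\<lambda>s. e1 s \<in> elts (e2 s))"
proof -
  have "definable N (\<lambda>s. sat M R (\<lambda>n. (if n = 0 then e1 else e2) s) (Mem 0 1))"
    by (rule definable_sat) (simp add: assms)
  then show ?thesis by simp
qed

lemma definable_eq:
  assumes "term_over N e1" and "term_over N e2"
  shows "definable N (\<lambda>s. e1 s = e2 s)"
proof -
  have "definable N (\<lambda>s. sat M R (\<lambda>n. (if n = 0 then e1 else e2) s) (Eq 0 1))"
    by (rule definable_sat) (simp add: assms)
  then show ?thesis by simp
qed

lemma definable_le:
  assumes "term_over N e1" and "term_over N e2"
  shows "definable N (\<lambda>s. (e1 s, e2 s) \<in> R)"
proof -
  have "definable N (\<lambda>s. sat M R (\<lambda>n. (if n = 0 then e1 else e2) s) (Le 0 1))"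
    by (rule definable_sat) (simp add: assms)
  then show ?thesis by simp
qed

lemma definable_not:
  assumes "definable N P"
  shows "definable N (\<lambda>s. \<not> P s)"
proof -
  obtain \<phi> e where "\<forall>n. term_over N (e n)"
    "\<forall>s. range s \<subseteq> M \<longrightarrow> (P s \<longleftrightarrow> sat M R (\<lambda>n. e n s) \<phi>)"
    using assms unfolding definable_def by blast
  then show ?thesis
    unfolding definable_def by (intro exI[of _ "Neg \<phi>"] exI[of _ e]) simp
qed

lemma definable_conj:
  assumes "definable N P" and "definable N Q"
  shows "definable N (\<lambda>s. P s \<and> Q s)"
proof -
  obtain \<phi> e where P: "\<forall>n. term_over N (e n)"
    "\<forall>s. range s \<subseteq> M \<longrightarrow> (P s \<longleftrightarrow> sat M R (\<lambda>n. e n s) \<phi>)"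
    using assms(1) unfolding definable_def by blast
  obtain \<psi> d where Q: "\<forall>n. term_over N (d n)"
    "\<forall>s. range s \<subseteq> M \<longrightarrow> (Q s \<longleftrightarrow> sat M R (\<lambda>n. d n s) \<psi>)"
    using assms(2) unfolding definable_def by blast
  \<comment> \<open>Even and odd variables keep the terms of the two formulas apart, so that one
    environment serves the conjunction.\<close>
  obtain \<phi>' where \<phi>': "\<forall>s. sat M R s \<phi>' \<longleftrightarrow> sat M R (\<lambda>n. s (2 * n)) \<phi>"
    using sat_rename[of M R "\<lambda>n. 2 * n" \<phi>] by blast
  obtain \<psi>' where \<psi>': "\<forall>s. sat M R s \<psi>' \<longleftrightarrow> sat M R (\<lambda>n. s (2 * n + 1)) \<psi>"
    using sat_rename[of M R "\<lambda>n. 2 * n + 1" \<psi>] by blast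
  show ?thesis
    unfolding definable_def
    by (intro exI[of _ "Conj \<phi>' \<psi>'"] exI[of _ "\<lambda>n. if even n then e (n div 2) else d (n div 2)"])
       (use P Q in \<open>simp add: \<phi>' \<psi>'\<close>)
qed

lemma definable_all:
  assumes "definable N (\<lambda>s. P (\<lambda>n. s (Suc n)) (s 0))"
  shows "definable N (\<lambda>s. \<forall>x \<in> M. P s x)"
proof -
  obtain \<phi> e where e: "\<And>n. term_over N (e n)"
    and \<phi>: "\<And>s. range s \<subseteq> M \<Longrightarrow> P (\<lambda>n. s (Suc n)) (s 0) \<longleftrightarrow> sat M R (\<lambda>n. e n s) \<phi>"
    using assms unfolding definable_def by blast
  \<comment> \<open>\<open>?z n\<close> says that the n-th term is the quantified variable, position
    0 of the extended assignment; every other term gets a counterpart \<open>d n\<close> over the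
    original assignment.\<close>
  let ?z = "\<lambda>n. e n = (\<lambda>s. s 0)"
  have "\<exists>d. term_over N d \<and> (?z n \<or> (\<forall>s x. d s = e n (case_nat x s)))" for n
    using e[of n, unfolded term_over_def]
  proof (elim disjE exE bexE)
    fix i assume e_n: "e n = (\<lambda>s. s i)"
    show ?thesis
    proof (cases i)
      case (Suc k)
      then show ?thesis using e_n by (intro exI[of _ "\<lambda>s. s k"]) (auto intro: term_over_var)
    qed (use e_n in \<open>auto simp: term_over_def\<close>)
  next
    fix p assume "p \<in> N" "e n = (\<lambda>s. p)"
    then show ?thesis by (intro exI[of _ "\<lambda>s. p"]) (auto intro: term_over_param)
  qed
  then obtain d where d: "\<And>n. term_over N (d n)"
    and de: "\<And>n s x. \<not> ?z n \<Longrightarrow> d n s = e n (case_nat x s)"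
    by metis
  \<comment> \<open>Variable 0 is to be bound by the new quantifier, so the other terms move up by
    one; hence \<open>d (n - 1)\<close> below.\<close>
  obtain \<psi> where \<psi>: "\<forall>s. sat M R s \<psi> \<longleftrightarrow> sat M R (\<lambda>n. s (if ?z n then 0 else Suc n)) \<phi>"
    using sat_rename[of M R "\<lambda>n. if ?z n then 0 else Suc n" \<phi>] by blast
  have "P s x \<longleftrightarrow> sat M R ((\<lambda>n. d (n - 1) s)(0 := x)) \<psi>" if "range s \<subseteq> M" "x \<in> M" for s x
  proof -
    have "range (case_nat x s) \<subseteq> M" using that by (auto simp: image_subset_iff split: nat.splits)
    then have "P s x \<longleftrightarrow> sat M R (\<lambda>n. e n (case_nat x s)) \<phi>"
      using \<phi>[of "case_nat x s"] by simp
    moreover have "(\<lambda>n. e n (case_nat x s)) =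
        (\<lambda>n. ((\<lambda>n. d (n - 1) s)(0 := x)) (if ?z n then 0 else Suc n))"
    proof
      fix n
      show "e n (case_nat x s) = ((\<lambda>n. d (n - 1) s)(0 := x)) (if ?z n then 0 else Suc n)"
        using de[of n s x] by (cases "?z n") (auto simp: fun_eq_iff)
    qed
    ultimately show ?thesis using \<psi> by simp
  qed
  then show ?thesis
    unfolding definable_def
    by (intro exI[of _ "All 0 \<psi>"] exI[of _ "\<lambda>n. d (n - 1)"]) (simp add: d)
qed

lemma definable_disj:
  assumes "definable N P" and "definable N Q"
  shows "definable N (\<lambda>s. P s \<or> Q s)"
  using definable_not[OF definable_conj[OF definable_not[OF assms(1)] definable_not[OF assms(2)]]]
  by simp

lemma definable_imp:
  assumes "definable N P" and "definable N Q"
  shows "definable N (\<lambda>s. P s \<longrightarrow> Q s)"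
  using definable_disj[OF definable_not[OF assms(1)] assms(2)] by simp

lemma definable_iff:
  assumes "definable N P" and "definable N Q"
  shows "definable N (\<lambda>s. P s \<longleftrightarrow> Q s)"
  using definable_conj[OF definable_imp[OF assms] definable_imp[OF assms(2,1)]]
  by (simp add: iff_conv_conj_imp)

lemma definable_ex:
  assumes "definable N (\<lambda>s. P (\<lambda>n. s (Suc n)) (s 0))"
  shows "definable N (\<lambda>s. \<exists>x \<in> M. P s x)"
  using definable_not[OF definable_all[OF definable_not[OF assms]]] by simp

lemmas definable_intros = term_over_var term_over_param definable_mem definable_eq definable_le
  definable_not definable_conj definable_disj definable_imp definable_iff definable_all definable_ex

lemma definable_cong:
  assumes "definable N Q" and "\<And>s. range s \<subseteq> M \<Longrightarrow> P s \<longleftrightarrow> Q s"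
  shows "definable N P"
  using assms unfolding definable_def by auto

lemma definable_true: "definable N (\<lambda>s. True)"
  by (rule definable_cong[of _ "\<lambda>s. s 0 = s 0"]) (intro definable_intros, simp)

lemma definable_finite_ball:
  assumes "finite J" and "\<And>j. j \<in> J \<Longrightarrow> definable N (P j)"
  shows "definable N (\<lambda>s. \<forall>j \<in> J. P j s)"
  using assms by (induction J) (auto intro!: definable_true definable_conj)

lemma definable_subst:
  assumes "definable N P" and "N \<subseteq> M" and e: "\<And>n. term_over N (\<lambda>s. e s n)"
  shows "definable N (\<lambda>s. P (e s))"
proof -
  obtain \<phi> d where d: "\<And>n. term_over N (d n)"
    and \<phi>: "\<And>s. range s \<subseteq> M \<Longrightarrow> P s \<longleftrightarrow> sat M R (\<lambda>n. d n s) \<phi>"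
    using assms(1) unfolding definable_def by blast
  have "e s n \<in> M" if "range s \<subseteq> M" for s n
    using e[of n] that \<open>N \<subseteq> M\<close> unfolding term_over_def by (auto simp: fun_eq_iff)
  then have "P (e s) \<longleftrightarrow> sat M R (\<lambda>n. d n (e s)) \<phi>" if "range s \<subseteq> M" for s
    using \<phi>[of "e s"] that by blast
  moreover have "term_over N (\<lambda>s. d n (e s))" for n
    using d[of n] e unfolding term_over_def by (elim disjE exE bexE) auto
  ultimately show ?thesis
    unfolding definable_def by (intro exI[of _ \<phi>] exI[of _ "\<lambda>n s. d n (e s)"]) simp
qed

lemma definable_ex_upd:
  assumes "definable N P" and "N \<subseteq> M"
  shows "definable N (\<lambda>s. \<exists>x \<in> M. P (s(j := x)))"
proof (rule definable_ex, rule definable_subst[OF assms])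
  show "term_over N (\<lambda>s. ((\<lambda>n. s (Suc n))(j := s 0)) n)" for n
    by (cases "n = j") (auto intro: term_over_var)
qed

text \<open>Serves to quantify away, all at once, the parameters of a Skolem term.\<close>

lemma definable_ex_block:
  assumes "finite J" and "definable N P" and "N \<subseteq> M"
  shows "definable N (\<lambda>s. \<exists>t. range t \<subseteq> M \<and> (\<forall>j. j \<notin> J \<longrightarrow> t j = s j) \<and> P t)"
  using assms(1)
proof (induction J)
  case empty
  show ?case
  proof (rule definable_cong[OF assms(2)])
    fix s :: "nat \<Rightarrow> 'v" assume "range s \<subseteq> M"
    moreover have "t = s" if "\<forall>j. j \<notin> {} \<longrightarrow> t j = s j" for t using that by auto
    ultimately show "(\<exists>t. range t \<subseteq> M \<and> (\<forall>j. j \<notin> {} \<longrightarrow> t j = s j) \<and> P t) \<longleftrightarrow> P s" by blast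
  qed
next
  case (insert k J)
  have eq: "(\<exists>t. range t \<subseteq> M \<and> (\<forall>j. j \<notin> insert k J \<longrightarrow> t j = s j) \<and> P t) \<longleftrightarrow>
      (\<exists>x \<in> M. \<exists>t. range t \<subseteq> M \<and> (\<forall>j. j \<notin> J \<longrightarrow> t j = (s(k := x)) j) \<and> P t)" for s
  proof
    assume "\<exists>t. range t \<subseteq> M \<and> (\<forall>j. j \<notin> insert k J \<longrightarrow> t j = s j) \<and> P t"
    then obtain t where "range t \<subseteq> M" "\<forall>j. j \<notin> insert k J \<longrightarrow> t j = s j" "P t" by blast
    then show "\<exists>x \<in> M. \<exists>t. range t \<subseteq> M \<and> (\<forall>j. j \<notin> J \<longrightarrow> t j = (s(k := x)) j) \<and> P t"
      by (intro bexI[of _ "t k"] exI[of _ t]) auto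
  next
    assume "\<exists>x \<in> M. \<exists>t. range t \<subseteq> M \<and> (\<forall>j. j \<notin> J \<longrightarrow> t j = (s(k := x)) j) \<and> P t"
    then show "\<exists>t. range t \<subseteq> M \<and> (\<forall>j. j \<notin> insert k J \<longrightarrow> t j = s j) \<and> P t"
      by (metis fun_upd_other insertCI)
  qed
  show ?case unfolding eq by (rule definable_ex_upd[OF insert.IH assms(3)])
qed

section \<open>Definably closed sets and Skolem hulls\<close>

text \<open>The form in which elementarity is used. As \<open>R\<close> well-orders
  \<open>M\<close>, least witnesses are definable, so this closure yields the Tarski-Vaught
  condition (\<open>def_closed_witness\<close>).\<close>

definition def_closed :: "'v set \<Rightarrow> bool" where
  "def_closed N \<longleftrightarrow> N \<subseteq> M \<and> N \<noteq> {} \<and>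
     (\<forall>\<phi> s x. range s \<subseteq> N \<longrightarrow> x \<in> M \<longrightarrow> (\<forall>y \<in> M. sat M R (s(0 := y)) \<phi> \<longleftrightarrow> y = x) \<longrightarrow> x \<in> N)"

lemma def_closed_subset: "def_closed N \<Longrightarrow> N \<subseteq> M"
  by (simp add: def_closed_def)

lemma def_closed_unique:
  assumes N: "def_closed N" and P: "definable N (\<lambda>s. P (s 0))"
    and x: "x \<in> M" "P x" "\<And>y. y \<in> M \<Longrightarrow> P y \<Longrightarrow> y = x"
  shows "x \<in> N"
proof -
  obtain \<phi> e where e: "\<And>n. term_over N (e n)"
    and \<phi>: "\<And>s. range s \<subseteq> M \<Longrightarrow> P (s 0) \<longleftrightarrow> sat M R (\<lambda>n. e n s) \<phi>"
    using P unfolding definable_def by blast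
  obtain d where d: "d \<in> N" using N unfolding def_closed_def by blast
  let ?v = "\<lambda>n. \<exists>i. e n = (\<lambda>s. s i)"
  define t where "t n = (if n = 0 \<or> ?v (n - 1) then d else e (n - 1) undefined)" for n
  have t: "range t \<subseteq> N"
  proof (clarify)
    fix n
    show "t n \<in> N" using e[of "n - 1"] d unfolding t_def term_over_def by (auto simp: fun_eq_iff)
  qed
  have tv: "e n s = t (Suc n)" if "\<not> ?v n" for n s
    using e[of n] that unfolding t_def term_over_def by auto
  obtain \<psi> where \<psi>: "\<forall>s. sat M R s \<psi> \<longleftrightarrow> sat M R (\<lambda>n. s (if ?v n then 0 else Suc n)) \<phi>"
    using sat_rename[of M R "\<lambda>n. if ?v n then 0 else Suc n" \<phi>] by blast
  have "sat M R (t(0 := y)) \<psi> \<longleftrightarrow> P y" if "y \<in> M" for y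
  proof -
    have "(\<lambda>n. (t(0 := y)) (if ?v n then 0 else Suc n)) = (\<lambda>n. e n (\<lambda>_. y))"
    proof
      fix n
      show "(t(0 := y)) (if ?v n then 0 else Suc n) = e n (\<lambda>_. y)"
      proof (cases "?v n")
        case True
        then show ?thesis by auto
      next
        case False
        then show ?thesis using tv[OF False, of "\<lambda>_. y"] by simp
      qed
    qed
    then show ?thesis using \<psi> \<phi>[of "\<lambda>_. y"] that by auto
  qed
  then have "\<forall>y \<in> M. sat M R (t(0 := y)) \<psi> \<longleftrightarrow> y = x" using x by blast
  then show ?thesis using N t x(1) unfolding def_closed_def by blast
qed

lemma least_exists:
  assumes "x \<in> M" and "P x"
  obtains y where "y \<in> M" "P y" "\<And>z. z \<in> M \<Longrightarrow> P z \<Longrightarrow> (y, z) \<in> R"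
proof -
  have "wf (R - Id)" and tot: "total_on M R" and rfl: "refl_on M R"
    using well_order unfolding well_order_on_def linear_order_on_def partial_order_on_def preorder_on_def
    by auto
  then obtain y where y: "y \<in> {z \<in> M. P z}" "\<And>z. (z, y) \<in> R - Id \<Longrightarrow> z \<notin> {z \<in> M. P z}"
    using wfE_min[of "R - Id" x "{z \<in> M. P z}"] assms by blast
  show ?thesis
  proof (rule that[of y])
    fix z assume z: "z \<in> M" "P z"
    show "(y, z) \<in> R"
      using y(1) y(2)[of z] z tot rfl unfolding total_on_def refl_on_def by (cases "y = z") auto
  qed (use y(1) in auto)
qed

lemma least_unique:
  assumes "(x, y) \<in> R" and "(y, x) \<in> R"
  shows "x = y"
  using well_order assms
  unfolding well_order_on_def linear_order_on_def partial_order_on_def antisym_def by blast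

lemma def_closed_least:
  assumes N: "def_closed N" and P: "definable N (\<lambda>s. P (s 0))"
    and x: "x \<in> M" "P x" "\<And>z. z \<in> M \<Longrightarrow> P z \<Longrightarrow> (x, z) \<in> R"
  shows "x \<in> N"
proof (rule def_closed_unique[OF N, of "\<lambda>y. P y \<and> (\<forall>z \<in> M. P z \<longrightarrow> (y, z) \<in> R)"])
  show "definable N (\<lambda>s. P (s 0) \<and> (\<forall>z \<in> M. P z \<longrightarrow> (s 0, z) \<in> R))"
    by (intro definable_intros P)
qed (use x least_unique in auto)

lemma def_closed_witness:
  assumes "def_closed N" and "definable N (\<lambda>s. P (s 0))" and "x \<in> M" "P x"
  shows "\<exists>y \<in> N. P y"
  using least_exists[of x P] def_closed_least[OF assms(1,2)] assms(3,4) by metis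

lemma definable1:
  assumes "definable N (\<lambda>s. P (s 0))" and "N \<subseteq> M" and "term_over N e"
  shows "definable N (\<lambda>s. P (e s))"
  using definable_subst[OF assms(1,2), of "\<lambda>s n. e s"] assms(3) by simp

lemma definable2:
  assumes "definable N (\<lambda>s. P (s 0) (s 1))" and "N \<subseteq> M" and "term_over N e1" "term_over N e2"
  shows "definable N (\<lambda>s. P (e1 s) (e2 s))"
proof -
  let ?e = "\<lambda>s n. (if n = (0::nat) then e1 else e2) s"
  have "definable N (\<lambda>s. P (?e s 0) (?e s 1))"
    by (rule definable_subst[OF assms(1,2), of ?e]) (simp add: assms(3,4))
  then show ?thesis by simp
qed

text \<open>Elementarity turns the existence of the defined element into a witness inside
  \<open>N\<close>, which satisfies the same formula in \<open>M\<close>; uniqueness identifies it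
  with \<open>x\<close>.\<close>

lemma elem_submodel_def_closed:
  assumes "elem_submodel N M R"
  shows "def_closed N"
  unfolding def_closed_def
proof (intro conjI allI impI)
  show N: "N \<subseteq> M" "N \<noteq> {}" using assms unfolding elem_submodel_def by auto
  have elem: "sat N R s \<phi> \<longleftrightarrow> sat M R s \<phi>" if "range s \<subseteq> N" for s \<phi>
    using assms that unfolding elem_submodel_def by blast
  fix \<phi> s x
  assume s: "range s \<subseteq> N" and x: "x \<in> M" "\<forall>y \<in> M. sat M R (s(0 := y)) \<phi> \<longleftrightarrow> y = x"
  have "\<not> sat M R s (All 0 (Neg \<phi>))" using x by auto
  then have "\<not> sat N R s (All 0 (Neg \<phi>))" using elem[OF s] by blast
  then obtain y where y: "y \<in> N" "sat N R (s(0 := y)) \<phi>" by auto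
  moreover have "range (s(0 := y)) \<subseteq> N" using s y(1) by auto
  ultimately have "sat M R (s(0 := y)) \<phi>" using elem by blast
  then show "x \<in> N" using x(2) y(1) N(1) by (metis subsetD)
qed

section \<open>Skolem hulls: closure, finite character, countability\<close>

abbreviation hull :: "'v set \<Rightarrow> 'v set" where
  "hull \<equiv> Skolem_hull M R"

lemma hull_subset: "W \<subseteq> M \<Longrightarrow> hull W \<subseteq> M"
proof
  fix x assume "W \<subseteq> M" "x \<in> hull W"
  then show "x \<in> M" using Skolem_hull.cases[of x M R W] by blast
qed

lemma hull_base: "W \<subseteq> hull W"
  by (auto intro: Skolem_hull.base)

lemma hull_mono:
  assumes "V \<subseteq> W"
  shows "hull V \<subseteq> hull W"
proof
  fix x assume "x \<in> hull V"
  then show "x \<in> hull W"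
  proof induction
    case (witness \<phi> i s x)
    then show ?case by (intro Skolem_hull.witness[of \<phi> i s]) auto
  qed (use assms in \<open>auto intro: Skolem_hull.base\<close>)
qed

lemma hull_def_closed:
  assumes "W \<subseteq> M" and "W \<noteq> {}"
  shows "def_closed (hull W)"
  unfolding def_closed_def
proof (intro conjI allI impI)
  show "hull W \<subseteq> M" "hull W \<noteq> {}" using assms hull_subset hull_base by blast+
  fix \<phi> s x
  assume "range s \<subseteq> hull W" and x: "x \<in> M" "\<forall>y \<in> M. sat M R (s(0 := y)) \<phi> \<longleftrightarrow> y = x"
  moreover have "(x, x) \<in> R"
    using x(1) well_order
    unfolding well_order_on_def linear_order_on_def partial_order_on_def preorder_on_def refl_on_def by blast
  ultimately show "x \<in> hull W" by (intro Skolem_hull.witness[of \<phi> 0 s]) auto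
qed

text \<open>Formulas have finitely many free variables, so finite supports of the parameters combine
  to a finite support of the witness.\<close>

lemma hull_finitary:
  assumes "x \<in> hull (N \<union> B)"
  shows "\<exists>F. finite F \<and> F \<subseteq> B \<and> x \<in> hull (N \<union> F)"
  using assms
proof induction
  case (base x)
  show ?case
  proof (cases "x \<in> N")
    case True
    then show ?thesis by (intro exI[of _ "{}"]) (auto intro: Skolem_hull.base)
  next
    case False
    then show ?thesis using base by (intro exI[of _ "{x}"]) (auto intro: Skolem_hull.base)
  qed
next
  case (witness \<phi> i s x)
  then obtain F where F: "\<forall>j \<in> fvars \<phi> - {i}. finite (F j) \<and> F j \<subseteq> B \<and> s j \<in> hull (N \<union> F j)"
    by metis
  let ?F = "\<Union>j \<in> fvars \<phi> - {i}. F j"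
  have "s j \<in> hull (N \<union> ?F)" if "j \<in> fvars \<phi> - {i}" for j
    using F that hull_mono[of "N \<union> F j" "N \<union> ?F"] by blast
  then have "x \<in> hull (N \<union> ?F)" using witness by (intro Skolem_hull.witness[of \<phi> i s]) auto
  moreover have "finite ?F" "?F \<subseteq> B" using F finite_fvars[of \<phi>] by auto
  ultimately show ?case by blast
qed

text \<open>There are countably many formulas, and finite lists code the relevant parameters, so the
  hull is covered by a sequence of countable stages.\<close>

lemma hull_countable:
  assumes "countable W"
  shows "countable (hull W)"
proof -
  define step :: "fm \<times> nat \<times> 'v list \<Rightarrow> 'v" where
    "step = (\<lambda>(\<phi>, i, l). THE x. x \<in> M \<and> sat M R ((\<lambda>j. l ! j)(i := x)) \<phi> \<and>
        (\<forall>y \<in> M. sat M R ((\<lambda>j. l ! j)(i := y)) \<phi> \<longrightarrow> (x, y) \<in> R))"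
  define stage where "stage = rec_nat W (\<lambda>_ S. S \<union> step ` (UNIV \<times> UNIV \<times> lists (insert undefined S)))"
  have stage_0: "stage 0 = W"
    and stage_Suc: "stage (Suc n) = stage n \<union> step ` (UNIV \<times> UNIV \<times> lists (insert undefined (stage n)))" for n
    by (simp_all add: stage_def)
  have mono: "m \<le> n \<Longrightarrow> stage m \<subseteq> stage n" for m n
    by (rule lift_Suc_mono_le[of stage]) (auto simp: stage_Suc)
  have "countable (stage n)" for n
    by (induction n) (auto simp: stage_0 stage_Suc assms intro!: countable_Un countable_image countable_SIGMA countable_lists)
  moreover have "x \<in> (\<Union>n. stage n)" if "x \<in> hull W" for x
    using that
  proof induction
    case (base x)
    then show ?case using stage_0 by auto
  next
    case (witness \<phi> i s x)
    let ?J = "fvars \<phi> - {i}"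
    have "\<forall>j \<in> ?J. \<exists>n. s j \<in> stage n" using witness(1) by blast
    from bchoice[OF this] obtain h where h: "\<forall>j \<in> ?J. s j \<in> stage (h j)" by blast
    \<comment> \<open>The sum bounds the stages of the finitely many parameters.\<close>
    define n where "n = (\<Sum>j \<in> ?J. h j)"
    have "h j \<le> n" if "j \<in> ?J" for j
      unfolding n_def using that finite_fvars[of \<phi>] by (intro member_le_sum) auto
    then have sn: "s j \<in> stage n" if "j \<in> ?J" for j using that h mono[of "h j" n] by blast
    obtain k where k: "\<forall>j \<in> fvars \<phi>. j < k"
      using finite_fvars[of \<phi>] finite_nat_set_iff_bounded by blast
    \<comment> \<open>Entries for irrelevant variables are \<open>undefined\<close>; this is why the
      stages use lists over \<open>insert undefined S\<close>.\<close>
    define l where "l = map (\<lambda>j. if j \<in> ?J then s j else undefined) [0..<k]"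
    have l: "l \<in> lists (insert undefined (stage n))" using sn by (auto simp: l_def)
    have sat_l: "sat M R ((\<lambda>j. l ! j)(i := y)) \<phi> \<longleftrightarrow> sat M R (s(i := y)) \<phi>" for y
      by (rule sat_cong) (use k in \<open>auto simp: l_def\<close>)
    have "step (\<phi>, i, l) = x"
      unfolding step_def prod.case sat_l
      by (rule the_equality) (use witness least_unique in auto)
    then have "x \<in> step ` (UNIV \<times> UNIV \<times> lists (insert undefined (stage n)))"
      using l by (intro image_eqI[of _ _ "(\<phi>, i, l)"]) auto
    then have "x \<in> stage (Suc n)" by (simp add: stage_Suc)
    then show ?case by blast
  qed
  ultimately show ?thesis
    by (intro countable_subset[of "hull W" "\<Union>n. stage n"] subsetI countable_UN) auto
qed

text \<open>A value of a Skolem function is the least witness of a formula, hence definable from the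
  parameters.\<close>

lemma hull_def_closed_eq:
  assumes N: "def_closed N"
  shows "hull N = N"
proof
  show "hull N \<subseteq> N"
  proof
    fix x assume "x \<in> hull N"
    then show "x \<in> N"
    proof induction
      case (witness \<phi> i s x)
      obtain d where d: "d \<in> N" using N unfolding def_closed_def by blast
      \<comment> \<open>Only the relevant free variables are known to take values in
        \<open>N\<close>; the other positions are overwritten by an element of
        \<open>N\<close>.\<close>
      let ?t = "\<lambda>j. if j \<in> fvars \<phi> - {i} then s j else d"
      have t: "sat M R (?t(i := y)) \<phi> \<longleftrightarrow> sat M R (s(i := y)) \<phi>" for y
        by (rule sat_cong) auto
      have "definable N (\<lambda>s. sat M R (?t(i := s 0)) \<phi>)"
      proof (rule definable_sat)
        show "term_over N (\<lambda>s. (?t(i := s 0)) n)" for n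
          using witness d by (cases "n = i") (auto intro: term_over_var term_over_param)
      qed
      then have "definable N (\<lambda>u. sat M R (s(i := u 0)) \<phi>)" unfolding t .
      then show ?case
        by (rule def_closed_least[OF N, where P = "\<lambda>y. sat M R (s(i := y)) \<phi>"]) (use witness in auto)
    qed
  qed
qed (rule hull_base)

text \<open>The elements of the hull of \<open>K \<union> {c}\<close> are the values at \<open>c\<close> of \<open>K\<close>-definable class functions.\<close>

lemma hull_insert_definable:
  assumes K: "def_closed K" and c: "c \<in> M" and y: "y \<in> hull (insert c K)"
  shows "\<exists>P. definable K (\<lambda>s. P (s 0) (s 1)) \<and> P c y \<and>
    (\<forall>a \<in> M. \<forall>x \<in> M. \<forall>x' \<in> M. P a x \<longrightarrow> P a x' \<longrightarrow> x = x')"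
  using y
proof induction
  case (base x)
  then consider "x = c" | "x \<in> K" by blast
  then show ?case
  proof cases
    case 1
    show ?thesis by (rule exI[of _ "\<lambda>a b. a = b"]) (use 1 in \<open>auto intro!: definable_intros\<close>)
  next
    case 2
    show ?thesis by (rule exI[of _ "\<lambda>a b. b = x"]) (use 2 in \<open>auto intro!: definable_intros\<close>)
  qed
next
  case (witness \<phi> i s x)
  note KM = def_closed_subset[OF K]
  let ?J = "fvars \<phi> - {i}"
  have sM: "s j \<in> M" if "j \<in> ?J" for j
    using that witness hull_subset[of "insert c K"] KM c by blast
  have "\<forall>j \<in> ?J. \<exists>P. definable K (\<lambda>s. P (s 0) (s 1)) \<and> P c (s j) \<and>
      (\<forall>a \<in> M. \<forall>x \<in> M. \<forall>x' \<in> M. P a x \<longrightarrow> P a x' \<longrightarrow> x = x')"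
    using witness(1) by blast
  from bchoice[OF this] obtain P where P: "\<And>j. j \<in> ?J \<Longrightarrow> definable K (\<lambda>s. P j (s 0) (s 1))"
    "\<And>j. j \<in> ?J \<Longrightarrow> P j c (s j)"
    "\<And>j a x x'. j \<in> ?J \<Longrightarrow> a \<in> M \<Longrightarrow> x \<in> M \<Longrightarrow> x' \<in> M \<Longrightarrow> P j a x \<Longrightarrow> P j a x' \<Longrightarrow> x = x'"
    by blast
  obtain k where k: "k \<notin> insert i (fvars \<phi>)"
    using finite_fvars ex_new_if_finite[OF infinite_UNIV_nat, of "insert i (fvars \<phi>)"] by blast
  obtain d where d: "d \<in> K" using K unfolding def_closed_def by blast
  \<comment> \<open>The fresh variable \<open>k\<close> holds the argument, \<open>i\<close> the
    value, and \<open>?J\<close> the parameters, which are functions of the argument.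
    \<open>L\<close> says that the parameters are computed correctly and the value is the least
    witness; \<open>T\<close> quantifies the parameters away.\<close>
  define L where "L t \<longleftrightarrow> (\<forall>j \<in> ?J. P j (t k) (t j)) \<and> sat M R t \<phi> \<and>
      (\<forall>y \<in> M. sat M R (t(i := y)) \<phi> \<longrightarrow> (t i, y) \<in> R)" for t
  define T where "T s \<longleftrightarrow> (\<exists>t. range t \<subseteq> M \<and> (\<forall>j. j \<notin> ?J \<longrightarrow> t j = s j) \<and> L t)" for s
  define Q where "Q a b \<longleftrightarrow> T ((\<lambda>_. d)(k := a, i := b))" for a b
  have 1: "definable K (\<lambda>t. \<forall>j \<in> ?J. P j (t k) (t j))"
    by (intro definable_finite_ball definable2[OF P(1) KM] term_over_var) (auto simp: finite_fvars)
  have 2: "definable K (\<lambda>t. sat M R t \<phi>)"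
    by (intro definable_sat term_over_var)
  have "definable K (\<lambda>t. \<forall>y \<in> M. sat M R (t(i := y)) \<phi> \<longrightarrow> (t i, y) \<in> R)"
  proof (intro definable_all definable_imp definable_le definable_sat)
    show "term_over K (\<lambda>s. ((\<lambda>n. s (Suc n))(i := s 0)) n)" for n
      by (cases "n = i") (auto intro: term_over_var)
  qed (rule term_over_var)+
  then have "definable K L"
    unfolding L_def
    by (rule definable_conj[OF 1 definable_conj[OF 2]])
  then have "definable K T"
    unfolding T_def by (intro definable_ex_block KM) (auto simp: finite_fvars)
  then have "definable K (\<lambda>s. Q (s 0) (s 1))"
    unfolding Q_def
  proof (rule definable_subst[OF _ KM])
    show "term_over K (\<lambda>s. ((\<lambda>_. d)(k := s 0, i := s 1)) n)" for n
      using d k by (cases "n = i"; cases "n = k") (auto intro: term_over_var term_over_param)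
  qed
  moreover have "Q c x"
  proof -
    let ?t = "\<lambda>j. if j \<in> ?J then s j else ((\<lambda>_. d)(k := c, i := x)) j"
    have t: "sat M R (?t(i := y)) \<phi> \<longleftrightarrow> sat M R (s(i := y)) \<phi>" for y
      by (rule sat_cong) auto
    have "sat M R ?t \<phi> \<longleftrightarrow> sat M R (s(i := x)) \<phi>"
      by (rule sat_cong) auto
    then have "L ?t"
      unfolding L_def t using witness P(2) k by auto
    moreover have "range ?t \<subseteq> M" using sM d KM c witness by auto
    ultimately show ?thesis unfolding Q_def T_def by (intro exI[of _ ?t]) auto
  qed
  moreover have "b = b'" if a: "a \<in> M" and "b \<in> M" "b' \<in> M" and Q: "Q a b" "Q a b'" for a b b'
  proof -
    obtain t where t: "range t \<subseteq> M" "\<forall>j. j \<notin> ?J \<longrightarrow> t j = ((\<lambda>_. d)(k := a, i := b)) j" "L t"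
      using Q(1) unfolding Q_def T_def by blast
    obtain t' where t': "range t' \<subseteq> M" "\<forall>j. j \<notin> ?J \<longrightarrow> t' j = ((\<lambda>_. d)(k := a, i := b')) j" "L t'"
      using Q(2) unfolding Q_def T_def by blast
    have ik: "t i = b" "t' i = b'" "t k = a" "t' k = a" using t(2) t'(2) k by auto
    have tM: "t j \<in> M" "t' j \<in> M" for j using t(1) t'(1) by (auto simp: image_subset_iff)
    \<comment> \<open>Both computations start from the argument \<open>a\<close>, so their
      parameters agree, and \<open>b\<close> and \<open>b'\<close> are least witnesses of the same
      formula.\<close>
    have tt: "t j = t' j" if "j \<in> ?J" for j
      using P(3)[OF that a tM] t(3) t'(3) that ik unfolding L_def by simp
    have eq: "sat M R (t(i := y)) \<phi> \<longleftrightarrow> sat M R (t'(i := y)) \<phi>" for y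
      by (rule sat_cong) (use tt in auto)
    have "t(i := b) = t" "t'(i := b') = t'" using ik by auto
    then have "sat M R (t(i := b)) \<phi>" "sat M R (t'(i := b')) \<phi>" using t(3) t'(3) unfolding L_def by auto
    then have "(b, b') \<in> R" "(b', b) \<in> R"
      using t(3) t'(3) eq that ik unfolding L_def by auto
    then show ?thesis by (rule least_unique)
  qed
  ultimately show ?case by (intro exI[of _ Q]) blast
qed

end

section \<open>The cumulative hierarchy\<close>

lemma UN_elts_in_range: "(\<Union>x \<in> elts (a :: 'v::zfc_universe). elts (f x :: 'v)) \<in> range elts"
  using union[of "vset (f ` elts a)"] by (simp add: elts_vset_image)

lemma vpair_set_in_range:
  assumes S: "S \<subseteq> {vpair x y |x y. x \<in> elts a \<and> y \<in> elts (b :: 'v::zfc_universe)}"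
  shows "S \<in> range elts"
proof -
  have "{vpair x y |x y. x \<in> elts a \<and> y \<in> elts b} = (\<Union>x \<in> elts a. elts (vset (vpair x ` elts b)))"
    by (auto simp: elts_vset_image)
  then obtain c where "elts c = {vpair x y |x y. x \<in> elts a \<and> y \<in> elts b}"
    using UN_elts_in_range[of "\<lambda>x. vset (vpair x ` elts b)" a] by auto
  then show ?thesis using separation[of S c] S by simp
qed

lemma V_stageI: "\<gamma> \<in> elts \<alpha> \<Longrightarrow> elts x \<subseteq> V_stage \<gamma> \<Longrightarrow> x \<in> V_stage \<alpha>"
  by (subst V_stage.simps) blast

lemma V_stage_mono: "elts \<gamma> \<subseteq> elts \<alpha> \<Longrightarrow> V_stage \<gamma> \<subseteq> V_stage \<alpha>"
  by (subst (1 2) V_stage.simps) blast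

lemma Ord_subset_V_stage: "Ord \<alpha> \<Longrightarrow> elts \<alpha> \<subseteq> V_stage \<alpha>"
proof (induction \<alpha> rule: mem_induct)
  case (1 \<alpha>)
  then show ?case using V_stageI Ord_mem by blast
qed

lemma elts_ord_succ: "elts (ord_succ \<alpha>) = insert \<alpha> (elts (\<alpha> :: 'v::zfc_universe))"
proof -
  have "insert \<alpha> (elts \<alpha>) = (\<Union>x \<in> elts (vset {vset {\<alpha>}, \<alpha>}). elts x)"
    by (simp add: elts_vset_doubleton elts_vset_singleton)
  also have "\<dots> \<in> range elts" by (rule union)
  finally show ?thesis unfolding ord_succ_def by (rule elts_vset)
qed

lemma V_stage_succI: "elts x \<subseteq> V_stage \<alpha> \<Longrightarrow> x \<in> V_stage (ord_succ \<alpha>)"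
  by (rule V_stageI[of \<alpha>]) (simp add: elts_ord_succ)

lemma Ord_succ: "Ord \<alpha> \<Longrightarrow> Ord (ord_succ \<alpha>)"
  unfolding Ord_def transitive_set_def elts_ord_succ by blast

text \<open>Were the successor of \<open>\<gamma>\<close> equal to \<open>\<kappa>\<close>, the
  infinite \<open>\<kappa>\<close> would have just one element more than \<open>\<gamma>\<close> and
  so be equipollent to it.\<close>

lemma infinite_Card_succ:
  assumes "Card \<kappa>" and "infinite (elts \<kappa>)" and "\<gamma> \<in> elts \<kappa>"
  shows "ord_succ \<gamma> \<in> elts \<kappa>"
proof -
  have \<kappa>: "Ord \<kappa>" and le: "elts \<gamma> \<prec> elts \<kappa>" using assms unfolding Card_def by auto
  consider "ord_succ \<gamma> \<in> elts \<kappa>" | "ord_succ \<gamma> = \<kappa>" | "\<kappa> \<in> elts (ord_succ \<gamma>)"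
    using Ord_linear[OF Ord_succ[OF Ord_mem[OF \<kappa> assms(3)]] \<kappa>] by blast
  then show ?thesis
  proof cases
    case 2
    then have eq: "elts \<kappa> = insert \<gamma> (elts \<gamma>)" using elts_ord_succ by metis
    then have "elts \<kappa> \<approx> elts \<gamma>" using assms(2) infinite_insert_eqpoll[of "elts \<gamma>" \<gamma>] by simp
    then show ?thesis using le lesspoll_def eqpoll_sym by blast
  next
    case 3
    then show ?thesis using assms(3) mem_irrefl[of \<kappa>] mem_asym[of \<gamma> \<kappa>] by (auto simp: elts_ord_succ)
  qed
qed

text \<open>A pair appears at most two stages above its components, and an infinite cardinal is
  closed under successors.\<close>

lemma vpair_in_V_stage:
  assumes \<kappa>: "Card \<kappa>" "infinite (elts \<kappa>)" and xy: "x \<in> V_stage \<kappa>" "y \<in> V_stage \<kappa>"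
  shows "vpair x y \<in> V_stage \<kappa>"
proof -
  obtain \<gamma> \<delta> where g: "\<gamma> \<in> elts \<kappa>" "elts x \<subseteq> V_stage \<gamma>" and d: "\<delta> \<in> elts \<kappa>" "elts y \<subseteq> V_stage \<delta>"
    using xy V_stage.simps[of \<kappa>] by blast
  have O: "Ord \<gamma>" "Ord \<delta>" using \<kappa> g d Ord_mem unfolding Card_def by blast+
  have "\<exists>\<eta> \<in> elts \<kappa>. elts x \<subseteq> V_stage \<eta> \<and> elts y \<subseteq> V_stage \<eta>"
    using Ord_linear[OF O] g d V_stage_mono[of \<gamma> \<delta>] V_stage_mono[of \<delta> \<gamma>] Ord_subset O by blast
  then obtain \<eta> where e: "\<eta> \<in> elts \<kappa>" "elts x \<subseteq> V_stage \<eta>" "elts y \<subseteq> V_stage \<eta>" by blast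
  have "elts (vpair x y) \<subseteq> V_stage (ord_succ (ord_succ \<eta>))"
    using V_stage_succI[OF e(2)] V_stage_succI[OF e(3)]
      V_stage_succI[of "vset {x}" "ord_succ \<eta>"] V_stage_succI[of "vset {x, y}" "ord_succ \<eta>"]
    by (simp add: elts_vpair elts_vset_singleton elts_vset_doubleton)
  then show ?thesis
    by (rule V_stageI[rotated]) (intro infinite_Card_succ \<kappa> e)
qed

lemma trcl_trans: "y \<in> elts x \<Longrightarrow> trcl y \<subseteq> trcl x"
  unfolding trcl_def by (auto intro: trancl_into_trancl)

lemma H_transitive: "x \<in> H \<theta> \<Longrightarrow> y \<in> elts x \<Longrightarrow> y \<in> H \<theta>"
  unfolding H_def using subset_imp_lepoll[OF trcl_trans] lesspoll_trans1 by blast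

section \<open>Measurable cardinals are larger than \<open>\<omega>\<^sub>1\<close>\<close>

text \<open>Rigidity of transitive sets: by induction on membership, \<open>h\<close> fixes every
  element.\<close>

lemma Ord_iso_eq:
  fixes a b :: "'v::zfc_universe"
  assumes "transitive_set a" "transitive_set b" and h: "bij_betw h (elts a) (elts b)"
    and iso: "\<And>x y. x \<in> elts a \<Longrightarrow> y \<in> elts a \<Longrightarrow> x \<in> elts y \<longleftrightarrow> h x \<in> elts (h y)"
  shows "a = b"
proof -
  have "y \<in> elts a \<longrightarrow> h y = y" for y
  proof (induction y rule: mem_induct)
    case (1 y)
    show ?case
    proof
      assume y: "y \<in> elts a"
      have hy: "h y \<in> elts b" using h y bij_betwE by blast
      have sub: "elts y \<subseteq> elts a" "elts (h y) \<subseteq> elts b"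
        using assms(1,2) y hy unfolding transitive_set_def by auto
      have surj: "\<exists>x \<in> elts a. h x = w" if "w \<in> elts b" for w
        using bij_betw_imp_surj_on[OF h] that by (metis imageE)
      have "elts (h y) = elts y"
      proof (intro set_eqI iffI)
        fix w assume w: "w \<in> elts (h y)"
        then obtain x where x: "x \<in> elts a" "h x = w" using surj sub(2) by blast
        then have "x \<in> elts y" using iso[OF x(1) y] w by simp
        then show "w \<in> elts y" using 1[of x] x by simp
      next
        fix x assume x: "x \<in> elts y"
        then have "x \<in> elts a" using sub(1) by blast
        then show "x \<in> elts (h y)" using iso[OF _ y, of x] 1[OF x] x by simp
      qed
      then show "h y = y" by (rule extensionality)
    qed
  qed
  then have "elts b = elts a" using h unfolding bij_betw_def by auto
  then show ?thesis by (metis extensionality)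
qed

lemma countable_lesspoll_uncountable:
  assumes "countable F" and "uncountable S"
  shows "F \<prec> S"
proof -
  have "F \<lesssim> (UNIV :: nat set)" using assms(1) by (simp add: countable_def lepoll_def)
  also have "\<dots> \<lesssim> S" using assms(2) infinite_countable_subset[of S] uncountable_infinite
    unfolding lepoll_def by blast
  finally have "F \<lesssim> S" .
  moreover have "\<not> F \<approx> S"
  proof
    assume "F \<approx> S"
    then have "S \<lesssim> F" by (rule eqpoll_imp_lepoll[OF eqpoll_sym])
    then show False using countable_lepoll assms by blast
  qed
  ultimately show ?thesis unfolding lesspoll_def by blast
qed

text \<open>
  Code a countable ordinal \<open>\<alpha>\<close> by a reflexive relation on the naturals isomorphic to \<open>\<in>\<close> on \<open>\<alpha>\<close>.
  If all members of \<open>\<kappa>\<close> were countable, a set in the ultrafilter would decide each pair of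
  naturals the same way, so that it would have only one element.
\<close>

lemma measurable_cardinal_uncountable_mem:
  fixes \<kappa> :: "'v::zfc_universe"
  assumes "measurable_cardinal \<kappa>"
  shows "\<exists>d \<in> elts \<kappa>. uncountable (elts d)"
proof (rule ccontr)
  assume n: "\<not> ?thesis"
  have \<kappa>: "Ord \<kappa>" "uncountable (elts \<kappa>)"
    using assms by (simp_all add: measurable_cardinal_def Card_def)
  from assms obtain U where U: "ultrafilter_on (elts \<kappa>) U"
    and np: "\<forall>\<xi> \<in> elts \<kappa>. {\<xi>} \<notin> U"
    and compl: "\<forall>F. F \<subseteq> U \<and> F \<noteq> {} \<and> F \<prec> elts \<kappa> \<longrightarrow> \<Inter>F \<in> U"
    unfolding measurable_cardinal_def by (elim conjE exE)
  have Usub: "U \<subseteq> Pow (elts \<kappa>)" and Une: "{} \<notin> U"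
    using U unfolding ultrafilter_on_def by simp_all
  define e :: "'v \<Rightarrow> 'v \<Rightarrow> nat" where "e a = to_nat_on (elts a)" for a
  have e: "inj_on (e a) (elts a)" if "a \<in> elts \<kappa>" for a
    unfolding e_def using n that by (intro inj_on_to_nat_on) auto
  \<comment> \<open>Including the diagonal makes the field of the code recoverable as its domain;
    without it, 0 and 1 would share the empty code.\<close>
  define r where "r a = {(e a x, e a y) |x y. x \<in> elts a \<and> y \<in> elts a \<and> (x = y \<or> x \<in> elts y)}" for a
  have r_iff: "(e a x, e a y) \<in> r a \<longleftrightarrow> x = y \<or> x \<in> elts y"
    if "a \<in> elts \<kappa>" "x \<in> elts a" "y \<in> elts a" for a x y
    using e[OF that(1)] that(2,3) unfolding r_def inj_on_def by auto
  have r_inj: "a = b" if a: "a \<in> elts \<kappa>" and b: "b \<in> elts \<kappa>" and r: "r a = r b" for a b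
  proof -
    have im: "e a ` elts a = Domain (r a)" for a unfolding r_def by force
    have "bij_betw (e a) (elts a) (e a ` elts a)" using e[OF a] by (simp add: bij_betw_def)
    moreover have "bij_betw (inv_into (elts b) (e b)) (e b ` elts b) (elts b)"
      by (rule bij_betw_inv_into[OF inj_on_imp_bij_betw[OF e[OF b]]])
    moreover have eq: "e a ` elts a = e b ` elts b" using im[of a] im[of b] r by simp
    ultimately have bij: "bij_betw (inv_into (elts b) (e b) \<circ> e a) (elts a) (elts b)"
      using bij_betw_trans by force
    have inv: "(inv_into (elts b) (e b) \<circ> e a) x \<in> elts b"
       "e b ((inv_into (elts b) (e b) \<circ> e a) x) = e a x" if "x \<in> elts a" for x
      using that eq by (auto intro: inv_into_into f_inv_into_f simp: image_iff)
        (metis (no_types) eq f_inv_into_f imageI inv_into_into)+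
    show ?thesis
    proof (rule Ord_iso_eq[OF _ _ bij])
      show "transitive_set a" "transitive_set b" using Ord_mem[OF \<kappa>(1)] a b unfolding Ord_def by auto
      fix x y assume x: "x \<in> elts a" and y: "y \<in> elts a"
      let ?h = "inv_into (elts b) (e b) \<circ> e a"
      have "?h x = ?h y \<longleftrightarrow> x = y" using bij x y unfolding bij_betw_def inj_on_def by blast
      moreover have "?h x = ?h y \<or> ?h x \<in> elts (?h y) \<longleftrightarrow> x = y \<or> x \<in> elts y"
        using r_iff[OF a x y] r_iff[OF b inv(1)[OF x] inv(1)[OF y]] inv(2)[OF x] inv(2)[OF y] r by simp
      ultimately show "x \<in> elts y \<longleftrightarrow> ?h x \<in> elts (?h y)" using mem_irrefl by metis
    qed
  qed
  define B where "B p = (if {a \<in> elts \<kappa>. p \<in> r a} \<in> U then {a \<in> elts \<kappa>. p \<in> r a}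
      else elts \<kappa> - {a \<in> elts \<kappa>. p \<in> r a})" for p
  have B: "B p \<in> U" for p
  proof -
    have "A \<in> U \<or> elts \<kappa> - A \<in> U" if "A \<subseteq> elts \<kappa>" for A
      using U that unfolding ultrafilter_on_def by blast
    from this[of "{a \<in> elts \<kappa>. p \<in> r a}"] show ?thesis unfolding B_def by auto
  qed
  have Bp: "p \<in> r a \<longleftrightarrow> p \<in> r b" if "a \<in> B p" "b \<in> B p" for p a b
    using that unfolding B_def by (auto split: if_splits)
  have "range B \<prec> elts \<kappa>" using \<kappa>(2) by (intro countable_lesspoll_uncountable) auto
  then have I: "\<Inter>(range B) \<in> U" using compl[rule_format, of "range B"] B by blast
  have sub: "\<Inter>(range B) \<subseteq> elts \<kappa>" using I Usub by blast
  have "\<Inter>(range B) \<noteq> {}" using I Une by metis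
  then obtain a where a: "a \<in> \<Inter>(range B)" by blast
  have "b = a" if "b \<in> \<Inter>(range B)" for b
  proof (rule r_inj)
    have "b \<in> B p" "a \<in> B p" for p using that a by blast+
    then show "r b = r a" using Bp by (intro set_eqI) blast
  qed (use that a sub in auto)
  then have "\<Inter>(range B) = {a}" using a by blast
  then show False using I np sub a by auto
qed

section \<open>First-order measures\<close>

lemma eq_vset_doubleton_iff':
  "z = vset {a, b} \<longleftrightarrow> a \<in> elts z \<and> b \<in> elts z \<and> (\<forall>t \<in> elts z. t = a \<or> t = (b :: 'v::zfc_universe))"
  unfolding eq_vset_doubleton_iff by blast

text \<open>All quantifiers are bounded by \<open>h\<close> or by sets found inside it, the form
  that \<open>definable_ball\<close> and \<open>definable_bex\<close> accept. \<open>q\<close> and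
  \<open>r\<close> stand for the members \<open>{a}\<close> and \<open>{a, b}\<close> of a
  Kuratowski pair.\<close>

lemma vpair_mem_iff:
  "vpair a b \<in> elts h \<longleftrightarrow> (\<exists>p \<in> elts h. \<exists>q \<in> elts p. \<exists>r \<in> elts p. (\<forall>t \<in> elts p. t = q \<or> t = r) \<and>
     (a \<in> elts q \<and> (\<forall>t \<in> elts q. t = a)) \<and>
     (a \<in> elts r \<and> b \<in> elts r \<and> (\<forall>t \<in> elts r. t = a \<or> t = (b :: 'v::zfc_universe))))" (is "_ \<longleftrightarrow> ?R")
proof
  assume "vpair a b \<in> elts h"
  then show ?R
    by (rule rev_bexI)
       (rule bexI[of _ "vset {a}"], rule bexI[of _ "vset {a, b}"],
        auto simp: elts_vpair elts_vset_singleton elts_vset_doubleton)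
next
  assume ?R
  then obtain p q r where p: "p \<in> elts h" "q \<in> elts p" "r \<in> elts p" "\<forall>t \<in> elts p. t = q \<or> t = r"
    and q: "a \<in> elts q" "\<forall>t \<in> elts q. t = a"
    and r: "a \<in> elts r" "b \<in> elts r" "\<forall>t \<in> elts r. t = a \<or> t = b" by blast
  have "q = vset {a}" using q eq_vset_singleton_iff by blast
  moreover have "r = vset {a, b}" using r eq_vset_doubleton_iff' by blast
  moreover have "elts p = {q, r}" using p by blast
  ultimately have "p = vpair a b" using eq_vpair_iff by blast
  then show "vpair a b \<in> elts h" using p by simp
qed

context wo_structure
begin

text \<open>By transitivity of \<open>M\<close>, a bounded quantifier is a guarded quantifier over
  \<open>M\<close>.\<close>

lemma definable_ball:
  assumes "definable N (\<lambda>s. P (\<lambda>n. s (Suc n)) (s 0))" and "term_over N e" and "N \<subseteq> M"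
  shows "definable N (\<lambda>s. \<forall>x \<in> elts (e s). P s x)"
proof (rule definable_cong)
  have shift: "term_over N (\<lambda>s. e (\<lambda>n. s (Suc n)))"
    using assms(2) unfolding term_over_def by auto
  show "definable N (\<lambda>s. \<forall>x \<in> M. x \<in> elts (e s) \<longrightarrow> P s x)"
    by (intro definable_all definable_imp assms(1) definable_mem shift term_over_var)
  fix s :: "nat \<Rightarrow> 'v" assume "range s \<subseteq> M"
  then have "e s \<in> M" using assms(2,3) unfolding term_over_def by auto
  then show "(\<forall>x \<in> elts (e s). P s x) \<longleftrightarrow> (\<forall>x \<in> M. x \<in> elts (e s) \<longrightarrow> P s x)"
    using transitive by blast
qed

lemma definable_bex:
  assumes "definable N (\<lambda>s. P (\<lambda>n. s (Suc n)) (s 0))" and "term_over N e" and "N \<subseteq> M"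
  shows "definable N (\<lambda>s. \<exists>x \<in> elts (e s). P s x)"
  using definable_not[OF definable_ball[OF definable_not[OF assms(1)] assms(2,3)]] by simp

lemma definable3:
  assumes "definable N (\<lambda>s. P (s 0) (s 1) (s 2))" and "N \<subseteq> M"
    and "term_over N e1" "term_over N e2" "term_over N e3"
  shows "definable N (\<lambda>s. P (e1 s) (e2 s) (e3 s))"
proof -
  let ?e = "\<lambda>s n. (if n = (0::nat) then e1 else if n = 1 then e2 else e3) s"
  have "definable N (\<lambda>s. P (?e s 0) (?e s 1) (?e s 2))"
    by (rule definable_subst[OF assms(1,2), of ?e]) (simp add: assms(3-5))
  then show ?thesis by simp
qed

lemma definable_vpair_mem:
  assumes "N \<subseteq> M" and "term_over N e1" "term_over N e2" "term_over N e3"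
  shows "definable N (\<lambda>s. vpair (e1 s) (e2 s) \<in> elts (e3 s))"
proof (rule definable3[OF _ assms])
  show "definable N (\<lambda>s. vpair (s 0) (s 1) \<in> elts (s 2))"
    unfolding vpair_mem_iff
    by (intro definable_ball definable_bex definable_conj definable_disj definable_mem definable_eq
        term_over_var assms(1))
qed

text \<open>
  The last clause is \<open>\<kappa>\<close>-completeness, with families of sets coded as relations \<open>h\<close> so that it
  is first-order over \<open>M\<close>.
\<close>

definition is_measure :: "'v \<Rightarrow> 'v \<Rightarrow> bool" where
  "is_measure \<kappa> u \<longleftrightarrow>
     (\<forall>A \<in> elts u. (\<forall>a \<in> elts A. a \<in> elts \<kappa>) \<and> (\<exists>a \<in> elts A. True)) \<and>
     (\<forall>A \<in> elts u. \<forall>B \<in> M. (\<forall>a \<in> elts A. a \<in> elts B) \<and> (\<forall>a \<in> elts B. a \<in> elts \<kappa>) \<longrightarrow> B \<in> elts u) \<and>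
     (\<forall>A \<in> M. (\<forall>a \<in> elts A. a \<in> elts \<kappa>) \<longrightarrow>
        A \<in> elts u \<or> (\<exists>B \<in> elts u. \<forall>a \<in> elts \<kappa>. a \<in> elts B \<longleftrightarrow> a \<notin> elts A)) \<and>
     (\<forall>a \<in> elts \<kappa>. \<exists>B \<in> elts u. a \<notin> elts B) \<and>
     (\<forall>x \<in> elts \<kappa>. \<forall>h \<in> M. (\<forall>\<xi> \<in> elts x. \<exists>A \<in> elts u. \<forall>a \<in> elts A. vpair \<xi> a \<in> elts h) \<longrightarrow>
        (\<exists>A \<in> elts u. \<forall>a \<in> elts A. \<forall>\<xi> \<in> elts x. vpair \<xi> a \<in> elts h))"

lemma definable_is_measure:
  assumes "N \<subseteq> M"
  shows "definable N (\<lambda>s. is_measure (s 0) (s 1))"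
  unfolding is_measure_def
  by (intro definable_ball definable_bex definable_all definable_conj definable_disj definable_imp definable_iff
      definable_not definable_mem definable_vpair_mem definable_true term_over_var assms)

lemma def_closed_comprehension:
  assumes "def_closed N" and "definable N (\<lambda>s. P (s 0))"
    and "z \<in> M" and z: "elts z = {a \<in> M. P a}"
  shows "z \<in> N"
proof (rule def_closed_unique[OF assms(1), of "\<lambda>z. \<forall>a \<in> M. a \<in> elts z \<longleftrightarrow> P a"])
  show "definable N (\<lambda>s. \<forall>a \<in> M. a \<in> elts (s 0) \<longleftrightarrow> P a)"
    by (intro definable_intros definable1[OF assms(2)] def_closed_subset assms(1))
  fix y assume "y \<in> M" "\<forall>a \<in> M. a \<in> elts y \<longleftrightarrow> P a"
  then have "elts y = elts z" using z transitive by blast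
  then show "y = z" by (rule extensionality)
qed (use assms(3) z in auto)

end

text \<open>A measure needs two stages above \<open>lam\<close>: subsets of \<open>lam\<close> and
  relations on \<open>lam\<close> appear at the first, sets of such subsets at the second.\<close>

locale measurable_structure = wo_structure M R
  for M :: "'v::zfc_universe set" and R +
  fixes lam :: 'v
  assumes measurable: "measurable_cardinal lam"
    and stage_subset: "V_stage (ord_succ (ord_succ lam)) \<subseteq> M"
begin

lemma Card_lam: "Card lam" and Ord_lam: "Ord lam" and uncountable_lam: "uncountable (elts lam)"
  using measurable by (simp_all add: measurable_cardinal_def Card_def)

lemma infinite_lam: "infinite (elts lam)"
  using uncountable_lam by (simp add: uncountable_infinite)

lemma subset_stage_in_M: "elts x \<subseteq> V_stage (ord_succ lam) \<Longrightarrow> x \<in> M"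
  using V_stage_succI stage_subset by blast

lemma stage_subset_succ: "V_stage lam \<subseteq> V_stage (ord_succ lam)"
  by (rule V_stage_mono) (auto simp: elts_ord_succ)

lemma lam_subset_M: "elts x \<subseteq> elts lam \<Longrightarrow> x \<in> M"
  using subset_stage_in_M Ord_subset_V_stage[OF Ord_lam] stage_subset_succ by blast

lemma lam_in_M: "lam \<in> M"
  by (rule lam_subset_M) simp

lemma mem_lam_in_M: "a \<in> elts lam \<Longrightarrow> a \<in> M"
  using lam_in_M transitive by blast

lemma relation_in_M:
  assumes "S \<subseteq> {vpair x y |x y. x \<in> elts lam \<and> y \<in> elts lam}"
  shows "vset S \<in> M" and "elts (vset S) = S"
proof -
  show eq: "elts (vset S) = S" by (rule elts_vset[OF vpair_set_in_range[OF assms]])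
  have "S \<subseteq> V_stage lam"
    using assms vpair_in_V_stage[OF Card_lam infinite_lam] Ord_subset_V_stage[OF Ord_lam] by blast
  then show "vset S \<in> M" using eq stage_subset_succ by (intro subset_stage_in_M) blast
qed

text \<open>The HOL ultrafilter is coded by a set \<open>u\<close>, and each first-order clause
  follows from its HOL counterpart; for completeness, the relation \<open>h\<close> is read as the
  family of its sections \<open>B \<xi>\<close>.\<close>

lemma measure_exists: "\<exists>u \<in> M. is_measure lam u"
proof -
  from measurable obtain U where U: "ultrafilter_on (elts lam) U"
    and np: "\<forall>\<xi> \<in> elts lam. {\<xi>} \<notin> U"
    and compl: "\<forall>F. F \<subseteq> U \<and> F \<noteq> {} \<and> F \<prec> elts lam \<longrightarrow> \<Inter>F \<in> U"
    unfolding measurable_cardinal_def by (elim conjE exE)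
  have Usub: "\<And>A. A \<in> U \<Longrightarrow> A \<subseteq> elts lam" and Ulam: "elts lam \<in> U" and Une: "{} \<notin> U"
    and Uup: "\<And>A B. A \<in> U \<Longrightarrow> A \<subseteq> B \<Longrightarrow> B \<subseteq> elts lam \<Longrightarrow> B \<in> U"
    and Uult: "\<And>A. A \<subseteq> elts lam \<Longrightarrow> A \<in> U \<or> elts lam - A \<in> U"
    using U unfolding ultrafilter_on_def by auto
  obtain P where P: "elts P = {y :: 'v. elts y \<subseteq> elts lam}" using power_set by (metis rangeE)
  define u where "u = vset {A. elts A \<in> U}"
  have u: "A \<in> elts u \<longleftrightarrow> elts A \<in> U" for A
    unfolding u_def using elts_vset_subset[of "{A. elts A \<in> U}" P] P Usub by blast
  have vU: "vset S \<in> elts u \<longleftrightarrow> S \<in> U" if "S \<subseteq> elts lam" for S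
    using that u elts_vset_subset by metis
  have "u \<in> M"
  proof (rule subset_stage_in_M, rule subsetI)
    fix A assume "A \<in> elts u"
    then have "elts A \<subseteq> V_stage lam" using u Usub Ord_subset_V_stage[OF Ord_lam] by blast
    then show "A \<in> V_stage (ord_succ lam)" by (rule V_stage_succI)
  qed
  moreover have "is_measure lam u"
    unfolding is_measure_def
  proof (intro conjI)
    show "\<forall>A \<in> elts u. (\<forall>a \<in> elts A. a \<in> elts lam) \<and> (\<exists>a \<in> elts A. True)"
      using u Usub Une by (metis ex_in_conv subsetD)
    show "\<forall>A \<in> elts u. \<forall>B \<in> M. (\<forall>a \<in> elts A. a \<in> elts B) \<and> (\<forall>a \<in> elts B. a \<in> elts lam) \<longrightarrow> B \<in> elts u"
    proof (intro ballI impI)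
      fix A B assume "A \<in> elts u" "(\<forall>a \<in> elts A. a \<in> elts B) \<and> (\<forall>a \<in> elts B. a \<in> elts lam)"
      then show "B \<in> elts u" unfolding u by (intro Uup[of "elts A" "elts B"]) auto
    qed
    show "\<forall>A \<in> M. (\<forall>a \<in> elts A. a \<in> elts lam) \<longrightarrow>
        A \<in> elts u \<or> (\<exists>B \<in> elts u. \<forall>a \<in> elts lam. a \<in> elts B \<longleftrightarrow> a \<notin> elts A)"
    proof (intro ballI impI)
      fix A assume A: "\<forall>a \<in> elts A. a \<in> elts lam"
      show "A \<in> elts u \<or> (\<exists>B \<in> elts u. \<forall>a \<in> elts lam. a \<in> elts B \<longleftrightarrow> a \<notin> elts A)"
      proof (cases "elts A \<in> U")
        case False
        then have "elts lam - elts A \<in> U" using Uult[of "elts A"] A by blast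
        then have "vset (elts lam - elts A) \<in> elts u" by (subst vU) auto
        then show ?thesis by (intro disjI2 bexI) (auto simp: elts_vset_subset[of _ lam])
      qed (simp add: u)
    qed
    show "\<forall>a \<in> elts lam. \<exists>B \<in> elts u. a \<notin> elts B"
    proof
      fix a assume a: "a \<in> elts lam"
      then have "elts lam - {a} \<in> U" using Uult[of "{a}"] np by auto
      then have "vset (elts lam - {a}) \<in> elts u" by (subst vU) auto
      then show "\<exists>B \<in> elts u. a \<notin> elts B" by (rule rev_bexI) (simp add: elts_vset_subset[of _ lam])
    qed
    show "\<forall>x \<in> elts lam. \<forall>h \<in> M. (\<forall>\<xi> \<in> elts x. \<exists>A \<in> elts u. \<forall>a \<in> elts A. vpair \<xi> a \<in> elts h) \<longrightarrow>
        (\<exists>A \<in> elts u. \<forall>a \<in> elts A. \<forall>\<xi> \<in> elts x. vpair \<xi> a \<in> elts h)"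
    proof (intro ballI impI)
      fix x h assume x: "x \<in> elts lam"
        and h: "\<forall>\<xi> \<in> elts x. \<exists>A \<in> elts u. \<forall>a \<in> elts A. vpair \<xi> a \<in> elts h"
      define B where "B \<xi> = {a \<in> elts lam. vpair \<xi> a \<in> elts h}" for \<xi>
      have B: "B \<xi> \<in> U" if "\<xi> \<in> elts x" for \<xi>
      proof -
        from bspec[OF h that] obtain A where A: "A \<in> elts u" "\<forall>a \<in> elts A. vpair \<xi> a \<in> elts h"
          by (rule bexE)
        have AU: "elts A \<in> U" using A(1) u by simp
        have "elts A \<subseteq> B \<xi>" using A(2) Usub[OF AU] unfolding B_def by blast
        then show ?thesis by (rule Uup[OF AU]) (auto simp: B_def)
      qed
      \<comment> \<open>HOL completeness concerns nonempty families, so an empty index set is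
        settled by \<open>lam\<close> itself.\<close>
      show "\<exists>A \<in> elts u. \<forall>a \<in> elts A. \<forall>\<xi> \<in> elts x. vpair \<xi> a \<in> elts h"
      proof (cases "elts x = {}")
        case True
        then show ?thesis using Ulam u by auto
      next
        case False
        have "elts x \<prec> elts lam" using x Card_lam unfolding Card_def by blast
        then have "B ` elts x \<prec> elts lam" using image_lepoll lesspoll_trans1 by blast
        then have I: "\<Inter>(B ` elts x) \<in> U" using compl False B by (simp add: image_subset_iff)
        then have sub: "\<Inter>(B ` elts x) \<subseteq> elts lam" by (rule Usub)
        then have "vset (\<Inter>(B ` elts x)) \<in> elts u" using I vU by blast
        then show ?thesis
          by (rule rev_bexI) (subst elts_vset_subset[OF sub], auto simp: B_def)
      qed
    qed
  qed
  ultimately show ?thesis by blast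
qed

definition mu :: 'v where
  "mu = (SOME u. u \<in> M \<and> is_measure lam u \<and> (\<forall>v \<in> M. is_measure lam v \<longrightarrow> (u, v) \<in> R))"

lemma mu: "mu \<in> M" "is_measure lam mu" "v \<in> M \<Longrightarrow> is_measure lam v \<Longrightarrow> (mu, v) \<in> R"
proof -
  obtain u0 where "u0 \<in> M" "is_measure lam u0" using measure_exists by blast
  then obtain u where "u \<in> M" "is_measure lam u" "\<And>v. v \<in> M \<Longrightarrow> is_measure lam v \<Longrightarrow> (u, v) \<in> R"
    using least_exists[of u0 "is_measure lam"] by blast
  then have "\<exists>u. u \<in> M \<and> is_measure lam u \<and> (\<forall>v \<in> M. is_measure lam v \<longrightarrow> (u, v) \<in> R)" by blast
  from someI_ex[OF this, folded mu_def]
  show "mu \<in> M" "is_measure lam mu" "v \<in> M \<Longrightarrow> is_measure lam v \<Longrightarrow> (mu, v) \<in> R" by blast+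
qed

lemma mu_in_def_closed:
  assumes "def_closed N" and "lam \<in> N"
  shows "mu \<in> N"
proof (rule def_closed_least[OF assms(1), where P = "is_measure lam"])
  show "definable N (\<lambda>s. is_measure lam (s 0))"
    by (intro definable2[OF definable_is_measure] def_closed_subset assms term_over_var term_over_param)
qed (use mu in auto)

section \<open>The measure in terms of HOL sets\<close>

definition large :: "'v set \<Rightarrow> bool" where
  "large S \<longleftrightarrow> S \<subseteq> elts lam \<and> vset S \<in> elts mu"

lemma elts_vset_lam: "S \<subseteq> elts lam \<Longrightarrow> elts (vset S) = S"
  by (rule elts_vset_subset)

lemma vset_lam_in_M: "S \<subseteq> elts lam \<Longrightarrow> vset S \<in> M"
  by (rule lam_subset_M) (simp add: elts_vset_lam)

lemma elts_mu: "\<forall>A \<in> elts mu. (\<forall>a \<in> elts A. a \<in> elts lam) \<and> (\<exists>a \<in> elts A. True)"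
  using mu(2) unfolding is_measure_def by (elim conjE)

lemma large_elts: "A \<in> elts mu \<Longrightarrow> large (elts A)"
  using elts_mu unfolding large_def by auto

lemma large_nonempty: "large S \<Longrightarrow> S \<noteq> {}"
  using elts_mu elts_vset_lam unfolding large_def by fastforce

lemma large_mono:
  assumes "large S" and "S \<subseteq> T" and "T \<subseteq> elts lam"
  shows "large T"
proof -
  have "\<forall>A \<in> elts mu. \<forall>B \<in> M. (\<forall>a \<in> elts A. a \<in> elts B) \<and> (\<forall>a \<in> elts B. a \<in> elts lam) \<longrightarrow> B \<in> elts mu"
    using mu(2) unfolding is_measure_def by (elim conjE)
  from this[rule_format, of "vset S" "vset T"] assms show ?thesis
    unfolding large_def using vset_lam_in_M by (auto simp: elts_vset_lam)
qed

lemma large_or_compl: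
  assumes "S \<subseteq> elts lam"
  shows "large S \<or> large (elts lam - S)"
proof -
  have "\<forall>A \<in> M. (\<forall>a \<in> elts A. a \<in> elts lam) \<longrightarrow>
        A \<in> elts mu \<or> (\<exists>B \<in> elts mu. \<forall>a \<in> elts lam. a \<in> elts B \<longleftrightarrow> a \<notin> elts A)"
    using mu(2) unfolding is_measure_def by (elim conjE)
  from this[rule_format, of "vset S"] assms
  consider "vset S \<in> elts mu" | B where "B \<in> elts mu" "\<forall>a \<in> elts lam. a \<in> elts B \<longleftrightarrow> a \<notin> S"
    using vset_lam_in_M by (auto simp: elts_vset_lam)
  then show ?thesis
  proof cases
    case 1
    then show ?thesis using assms by (simp add: large_def)
  next
    case 2
    then have "large (elts B)" by (intro large_elts)
    moreover have "elts B \<subseteq> elts lam" using calculation by (simp add: large_def)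
    ultimately show ?thesis using 2 large_mono[of "elts B" "elts lam - S"] by blast
  qed
qed

lemma large_lam: "large (elts lam)"
  using large_or_compl[of "elts lam"] large_nonempty by auto

text \<open>\<open>M\<close> contains every relation on \<open>lam\<close>, so an arbitrary HOL
  family \<open>B\<close> is coded by some \<open>h\<close> in \<open>M\<close>, to which the
  completeness clause of \<open>mu\<close> applies.\<close>

lemma large_Inter:
  assumes x: "x \<in> elts lam" and B: "\<And>\<xi>. \<xi> \<in> elts x \<Longrightarrow> large (B \<xi>)"
  shows "large {a \<in> elts lam. \<forall>\<xi> \<in> elts x. a \<in> B \<xi>}"
proof -
  define h where "h = vset {vpair \<xi> a |\<xi> a. \<xi> \<in> elts x \<and> a \<in> B \<xi>}"
  have sub: "{vpair \<xi> a |\<xi> a. \<xi> \<in> elts x \<and> a \<in> B \<xi>} \<subseteq> {vpair x y |x y. x \<in> elts lam \<and> y \<in> elts lam}"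
    using B Ord_subset[OF Ord_lam x] unfolding large_def by blast
  have h: "h \<in> M" and eh: "vpair \<xi> a \<in> elts h \<longleftrightarrow> \<xi> \<in> elts x \<and> a \<in> B \<xi>" for \<xi> a
    using relation_in_M[OF sub] unfolding h_def by (auto simp: vpair_eq_iff)
  have "\<forall>x \<in> elts lam. \<forall>h \<in> M. (\<forall>\<xi> \<in> elts x. \<exists>A \<in> elts mu. \<forall>a \<in> elts A. vpair \<xi> a \<in> elts h) \<longrightarrow>
        (\<exists>A \<in> elts mu. \<forall>a \<in> elts A. \<forall>\<xi> \<in> elts x. vpair \<xi> a \<in> elts h)"
    using mu(2) unfolding is_measure_def by (elim conjE)
  from bspec[OF bspec[OF this x] h]
  have "(\<forall>\<xi> \<in> elts x. \<exists>A \<in> elts mu. \<forall>a \<in> elts A. vpair \<xi> a \<in> elts h) \<longrightarrow>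
      (\<exists>A \<in> elts mu. \<forall>a \<in> elts A. \<forall>\<xi> \<in> elts x. vpair \<xi> a \<in> elts h)" .
  moreover have "\<forall>\<xi> \<in> elts x. \<exists>A \<in> elts mu. \<forall>a \<in> elts A. vpair \<xi> a \<in> elts h"
  proof
    fix \<xi> assume \<xi>: "\<xi> \<in> elts x"
    then have "vset (B \<xi>) \<in> elts mu" "elts (vset (B \<xi>)) = B \<xi>"
      using B elts_vset_lam unfolding large_def by auto
    then show "\<exists>A \<in> elts mu. \<forall>a \<in> elts A. vpair \<xi> a \<in> elts h"
      using \<xi> by (auto simp: eh)
  qed
  ultimately obtain A where A: "A \<in> elts mu" "\<forall>a \<in> elts A. \<forall>\<xi> \<in> elts x. vpair \<xi> a \<in> elts h" by blast
  have "large (elts A)" using A large_elts by blast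
  then show ?thesis
    by (rule large_mono) (use A elts_mu in \<open>auto simp: eh\<close>)
qed

lemma large_remove: "a \<in> elts lam \<Longrightarrow> large (elts lam - {a})"
proof -
  assume a: "a \<in> elts lam"
  have "\<forall>a \<in> elts lam. \<exists>B \<in> elts mu. a \<notin> elts B"
    using mu(2) unfolding is_measure_def by (elim conjE)
  then obtain B where B: "B \<in> elts mu" "a \<notin> elts B" using a by blast
  show ?thesis
    by (rule large_mono[OF large_elts[OF B(1)]]) (use B large_elts[OF B(1)] in \<open>auto simp: large_def\<close>)
qed

text \<open>Nonprincipality allows each point up to \<open>x\<close> to be removed, and completeness
  allows them to be removed together, since the successor of \<open>x\<close> is below
  \<open>lam\<close>.\<close>

lemma large_above:
  assumes x: "x \<in> elts lam"
  shows "large {y \<in> elts lam. x \<in> elts y}"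
proof (rule large_mono)
  have sx: "ord_succ x \<in> elts lam" by (rule infinite_Card_succ[OF Card_lam infinite_lam x])
  show "large {a \<in> elts lam. \<forall>\<xi> \<in> elts (ord_succ x). a \<in> elts lam - {\<xi>}}"
    by (rule large_Inter[OF sx]) (use sx Ord_subset[OF Ord_lam sx] in \<open>auto intro: large_remove\<close>)
  show "{a \<in> elts lam. \<forall>\<xi> \<in> elts (ord_succ x). a \<in> elts lam - {\<xi>}} \<subseteq> {y \<in> elts lam. x \<in> elts y}"
  proof clarify
    fix y assume y: "y \<in> elts lam" "\<forall>\<xi> \<in> elts (ord_succ x). y \<in> elts lam - {\<xi>}"
    then show "x \<in> elts y"
      using Ord_linear[OF Ord_mem[OF Ord_lam x] Ord_mem[OF Ord_lam y(1)]] by (auto simp: elts_ord_succ)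
  qed
qed auto

text \<open>Completeness is indexed by elements of \<open>lam\<close>; an uncountable
  \<open>d\<close> below \<open>lam\<close> is long enough to index any countable family.\<close>

lemma countable_large_common:
  assumes F: "countable F" "F \<noteq> {}" and large: "\<And>S. S \<in> F \<Longrightarrow> large S"
  shows "\<exists>c \<in> elts lam. \<forall>S \<in> F. c \<in> S"
proof -
  obtain d where d: "d \<in> elts lam" "uncountable (elts d)"
    using measurable_cardinal_uncountable_mem[OF measurable] by blast
  then have "F \<lesssim> elts d" using countable_lesspoll_uncountable[OF F(1)] lesspoll_imp_lepoll by blast
  then obtain g where g: "F \<subseteq> g ` elts d" using lepoll_iff by metis
  \<comment> \<open>\<open>g\<close> covers \<open>F\<close> but may take values outside it; such
    indices receive the trivial large set.\<close>
  have "large {a \<in> elts lam. \<forall>\<xi> \<in> elts d. a \<in> (if g \<xi> \<in> F then g \<xi> else elts lam)}"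
    by (rule large_Inter[OF d(1)]) (use large large_lam in auto)
  then obtain c where c: "c \<in> elts lam" "\<forall>\<xi> \<in> elts d. c \<in> (if g \<xi> \<in> F then g \<xi> else elts lam)"
    using large_nonempty by blast
  have "c \<in> S" if "S \<in> F" for S
    using c(2) g that by (metis imageE subsetD)
  then show ?thesis using c(1) by blast
qed

section \<open>Generic ordinals\<close>

definition generic :: "'v \<Rightarrow> 'v set \<Rightarrow> bool" where
  "generic c K \<longleftrightarrow> c \<in> elts lam \<and> (\<forall>A \<in> K \<inter> elts mu. c \<in> elts A)"

lemma generic_antimono: "generic c K \<Longrightarrow> L \<subseteq> K \<Longrightarrow> generic c L"
  unfolding generic_def by blast

lemma generic_large:
  assumes "generic c K" and "large S" and "vset S \<in> K"
  shows "c \<in> S"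
  using assms elts_vset_lam[of S] unfolding generic_def large_def by blast

lemma generic_exists:
  assumes "countable K"
  shows "\<exists>c. generic c K"
proof -
  have "\<exists>c \<in> elts lam. \<forall>S \<in> insert (elts lam) (elts ` (K \<inter> elts mu)). c \<in> S"
  proof (rule countable_large_common)
    show "countable (insert (elts lam) (elts ` (K \<inter> elts mu)))" using assms by simp
    show "large S" if "S \<in> insert (elts lam) (elts ` (K \<inter> elts mu))" for S
      using that large_lam large_elts by auto
  qed simp
  then obtain c where "c \<in> elts lam" "\<forall>S \<in> insert (elts lam) (elts ` (K \<inter> elts mu)). c \<in> S"
    by (rule bexE)
  then show ?thesis unfolding generic_def by (intro exI[of _ c]) simp
qed

text \<open>Well-founded recursion along membership on the whole universe. For countable
  \<open>a\<close> the hull is countable, so the choice made at \<open>a\<close> succeeds.\<close>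

lemma generic_sequence:
  assumes "countable W"
  shows "\<exists>g. \<forall>a :: 'v. countable (elts a) \<longrightarrow> generic (g a) (hull (W \<union> g ` elts a))"
proof -
  let ?r = "{(x, y :: 'v). x \<in> elts y}"
  define G where "G g a = (SOME c. generic c (hull (W \<union> g ` elts a)))" for g :: "'v \<Rightarrow> 'v" and a
  define g where "g = wfrec ?r G"
  have g: "g a = (SOME c. generic c (hull (W \<union> g ` elts a)))" for a
  proof -
    have "g a = G (cut g ?r a) a" unfolding g_def by (rule wfrec[OF foundation])
    moreover have "cut g ?r a ` elts a = g ` elts a" by (auto simp: cut_def)
    ultimately show ?thesis by (simp add: G_def)
  qed
  have "generic (g a) (hull (W \<union> g ` elts a))" if "countable (elts a)" for a
  proof -
    have "countable (hull (W \<union> g ` elts a))" using that assms by (intro hull_countable) auto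
    then show ?thesis using someI_ex[OF generic_exists] g by metis
  qed
  then show ?thesis by (intro exI[of _ g]) simp
qed

lemma vset_lam_in_def_closed:
  assumes "def_closed K" and "definable K (\<lambda>s. P (s 0))" and "lam \<in> K"
  shows "vset {a \<in> elts lam. P a} \<in> K"
proof (rule def_closed_comprehension[OF assms(1), where P = "\<lambda>a. a \<in> elts lam \<and> P a"])
  show "definable K (\<lambda>s. s 0 \<in> elts lam \<and> P (s 0))"
    by (intro definable_conj definable_mem assms term_over_var term_over_param)
  show "elts (vset {a \<in> elts lam. P a}) = {a \<in> M. a \<in> elts lam \<and> P a}"
    using mem_lam_in_M by (subst elts_vset_lam) auto
qed (rule vset_lam_in_M, blast)

text \<open>The final segment above \<open>x\<close> is large and definable from \<open>x\<close>
  and \<open>lam\<close>.\<close>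

lemma generic_above:
  assumes "def_closed K" "lam \<in> K" and "generic c K" and "x \<in> K" "x \<in> elts lam"
  shows "x \<in> elts c"
proof -
  have "vset {y \<in> elts lam. x \<in> elts y} \<in> K"
    by (rule vset_lam_in_def_closed) (intro assms definable_mem term_over_var term_over_param)+
  then show ?thesis using generic_large[OF assms(3) large_above[OF assms(5)]] by blast
qed

text \<open>
  A \<open>K\<close>-definable partition of a large set into fewer than \<open>\<lambda>\<close> pieces has a unique large piece,
  whose index is in \<open>K\<close>, and a generic ordinal belongs to this piece.
\<close>

lemma generic_end_extension:
  assumes K: "def_closed K" "lam \<in> K" and c: "generic c K"
    and x: "x \<in> K" "x \<in> elts lam" and y: "y \<in> hull (insert c K)" "y \<in> elts x"
  shows "y \<in> K"
proof -
  note KM = def_closed_subset[OF K(1)]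
  have cl: "c \<in> elts lam" using c by (simp add: generic_def)
  obtain P where P: "definable K (\<lambda>s. P (s 0) (s 1))" and Pc: "P c y"
    and fn: "\<forall>a \<in> M. \<forall>x \<in> M. \<forall>x' \<in> M. P a x \<longrightarrow> P a x' \<longrightarrow> x = x'"
    using hull_insert_definable[OF K(1) mem_lam_in_M[OF cl] y(1)] by blast
  have xM: "\<xi> \<in> M" if "\<xi> \<in> elts x" for \<xi>
    using that transitive x(1) KM by blast
  \<comment> \<open>\<open>P\<close> is the graph of a partial function with value \<open>y\<close>
    at \<open>c\<close>. \<open>A\<close> collects the arguments with a value in \<open>x\<close>,
    and the sets \<open>B \<xi>\<close> are its fibres.\<close>
  define A where "A = {a \<in> elts lam. \<exists>\<xi> \<in> elts x. P a \<xi>}"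
  define B where "B \<xi> = {a \<in> elts lam. P a \<xi>}" for \<xi>
  have sub: "A \<subseteq> elts lam" "B \<xi> \<subseteq> elts lam" for \<xi> unfolding A_def B_def by auto
  have not_both: "\<exists>a \<in> elts lam. a \<in> S \<and> a \<in> T" if "large S" "large T" for S T
    using countable_large_common[of "{S, T}"] that by auto
  \<comment> \<open>Otherwise the complement of \<open>A\<close> would be large; being coded in
    \<open>K\<close>, it would contain \<open>c\<close>, which lies in \<open>A\<close>.\<close>
  have "large A"
  proof (rule ccontr)
    assume "\<not> large A"
    then have "large (elts lam - A)" using large_or_compl[OF sub(1)] by blast
    moreover have "elts lam - A = {a \<in> elts lam. \<not> (\<exists>\<xi> \<in> elts x. P a \<xi>)}" by (auto simp: A_def)
    moreover have "vset {a \<in> elts lam. \<not> (\<exists>\<xi> \<in> elts x. P a \<xi>)} \<in> K"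
      by (rule vset_lam_in_def_closed)
         (intro K KM definable_not definable_bex definable2[OF P] term_over_var term_over_param x)+
    ultimately have "c \<in> elts lam - A" using generic_large[OF c] by metis
    then show False using Pc y(2) cl by (auto simp: A_def)
  qed
  have "\<exists>\<xi> \<in> elts x. large (B \<xi>)"
  proof (rule ccontr)
    assume n: "\<not> ?thesis"
    have "large {a \<in> elts lam. \<forall>\<xi> \<in> elts x. a \<in> elts lam - B \<xi>}"
      by (rule large_Inter[OF x(2)]) (use n large_or_compl[OF sub(2)] in blast)
    from not_both[OF \<open>large A\<close> this] show False by (auto simp: A_def B_def)
  qed
  then obtain \<xi> where \<xi>: "\<xi> \<in> elts x" "large (B \<xi>)" by blast
  \<comment> \<open>A fibre is large when it includes a member of \<open>mu\<close>, a condition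
    definable over \<open>K\<close> as \<open>mu\<close> is in \<open>K\<close>. Two large sets meet
    and \<open>P\<close> is single-valued, so the index is unique.\<close>
  have "\<xi> \<in> K"
  proof (rule def_closed_unique[OF K(1), of "\<lambda>\<xi>. \<xi> \<in> elts x \<and> (\<exists>A \<in> elts mu. \<forall>a \<in> elts A. P a \<xi>)"])
    show "definable K (\<lambda>s. s 0 \<in> elts x \<and> (\<exists>A \<in> elts mu. \<forall>a \<in> elts A. P a (s 0)))"
      by (intro definable_conj definable_mem definable_bex definable_ball definable2[OF P] KM
          term_over_var term_over_param x mu_in_def_closed K)
    show "\<xi> \<in> elts x \<and> (\<exists>A \<in> elts mu. \<forall>a \<in> elts A. P a \<xi>)"
      using \<xi> elts_vset_lam[OF sub(2)] unfolding large_def by (auto simp: B_def)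
    fix \<zeta> assume \<zeta>: "\<zeta> \<in> elts x \<and> (\<exists>A \<in> elts mu. \<forall>a \<in> elts A. P a \<zeta>)"
    then obtain A where A: "A \<in> elts mu" "\<forall>a \<in> elts A. P a \<zeta>" by blast
    then obtain a where "a \<in> elts lam" "a \<in> elts A" "a \<in> B \<xi>"
      using not_both[OF large_elts[OF A(1)] \<xi>(2)] by blast
    then have "a \<in> elts lam" "P a \<zeta>" "P a \<xi>" using A(2) by (auto simp: B_def)
    then show "\<zeta> = \<xi>" using fn mem_lam_in_M xM \<zeta> \<xi>(1) by blast
  qed (rule xM[OF \<xi>(1)])
  then have "vset (B \<xi>) \<in> K"
    unfolding B_def
    by (intro vset_lam_in_def_closed K definable2[OF P] KM term_over_var term_over_param)
  then have "P c \<xi>" using generic_large[OF c \<xi>(2)] by (auto simp: B_def)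
  then have "y = \<xi>" using fn mem_lam_in_M[OF cl] xM y(2) \<xi>(1) Pc by blast
  then show ?thesis using \<open>\<xi> \<in> K\<close> by simp
qed

text \<open>Each element of \<open>F\<close> is generic over the smaller ones, so \<open>F\<close>
  is peeled off from its largest element: \<open>generic_end_extension\<close> moves
  \<open>y\<close> into the hull of \<open>K\<close> and the rest, and the induction continues
  there.\<close>

lemma generic_finite_end_extension:
  assumes K: "def_closed K" "lam \<in> K" and "finite F"
    and "\<And>c. c \<in> F \<Longrightarrow> generic c (hull (K \<union> {d \<in> F. d \<in> elts c}))"
    and x: "x \<in> K" "x \<in> elts lam" and "y \<in> hull (K \<union> F)" "y \<in> elts x"
  shows "y \<in> K"
  using assms(3,4,7)
proof (induction "card F" arbitrary: F)
  case 0
  then show ?case using hull_def_closed_eq[OF K(1)] by simp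
next
  case (Suc n)
  have Fl: "F \<subseteq> elts lam" using Suc.prems(2) unfolding generic_def by blast
  have "F \<noteq> {}" using Suc.hyps(2) by auto
  then obtain m where m: "m \<in> F" "\<forall>d \<in> F. d = m \<or> d \<in> elts m"
    using finite_Ord_max[OF Suc.prems(1)] Fl Ord_mem[OF Ord_lam] by blast
  let ?F = "F - {m}"
  let ?K = "hull (K \<union> ?F)"
  have KF: "K \<union> ?F \<subseteq> M" "K \<union> ?F \<noteq> {}"
    using def_closed_subset[OF K(1)] K(2) Fl mem_lam_in_M by auto
  have "?F = {d \<in> F. d \<in> elts m}" using m mem_irrefl[of m] by auto
  then have gm: "generic m ?K" using Suc.prems(2)[OF m(1)] by simp
  have KK: "K \<subseteq> ?K" using hull_base[of "K \<union> ?F"] by blast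
  have lamx: "lam \<in> ?K" "x \<in> ?K" using KK K(2) x(1) by blast+
  have "K \<union> F \<subseteq> insert m ?K" using hull_base[of "K \<union> ?F"] by blast
  then have "y \<in> hull (insert m ?K)" using Suc.prems(3) hull_mono by blast
  then have "y \<in> ?K"
    by (rule generic_end_extension[OF hull_def_closed[OF KF] lamx(1) gm lamx(2) x(2) _ assms(8)])
  moreover have "generic c (hull (K \<union> {d \<in> ?F. d \<in> elts c}))" if "c \<in> ?F" for c
  proof (rule generic_antimono)
    show "generic c (hull (K \<union> {d \<in> F. d \<in> elts c}))" using Suc.prems(2) that by simp
  qed (rule hull_mono, blast)
  ultimately show ?case
    using Suc.hyps(1)[of ?F] Suc.hyps(2) Suc.prems(1) m(1) by simp
qed

section \<open>The sets \<open>D\<close>\<close>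

lemma vpair_mem_M:
  assumes "f \<in> M" and "vpair a b \<in> elts f"
  shows "a \<in> M" "b \<in> M"
proof -
  have "vset {a, b} \<in> M" using assms transitive[OF transitive[OF assms]] by (simp add: elts_vpair)
  then show "a \<in> M" "b \<in> M" using transitive by (simp_all add: elts_vset_doubleton)
qed

text \<open>A finite \<open>a\<close> is definable from its elements, and the value is definable
  from \<open>f\<close> and \<open>a\<close>.\<close>

lemma vapp_in_hull:
  assumes Z: "def_closed Z" and f: "f \<in> Z" "vfun f A B" and a: "a \<in> A" "finite (elts a)" "elts a \<subseteq> M"
  shows "vapp f a \<in> hull (Z \<union> elts a)"
proof -
  let ?K = "hull (Z \<union> elts a)"
  have ZM: "Z \<union> elts a \<subseteq> M" "Z \<union> elts a \<noteq> {}" using def_closed_subset[OF Z] f a by auto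
  note K = hull_def_closed[OF ZM] and KM = hull_subset[OF ZM(1)]
  have sub: "Z \<subseteq> ?K" "elts a \<subseteq> ?K" using hull_base by blast+
  have fM: "f \<in> M" using def_closed_subset[OF Z] f by blast
  note app = vapp_eqI[OF f(2) a(1)]
  show ?thesis
  \<comment> \<open>\<open>b\<close> is forced to have the elements of \<open>a\<close>. The negated
    finite conjunction expresses that \<open>t\<close> is one of them, so
    \<open>definable_finite_ball\<close> covers both clauses.\<close>
  proof (rule def_closed_unique[OF K, of "\<lambda>y. \<exists>b \<in> M. vpair b y \<in> elts f \<and>
        (\<forall>t \<in> elts b. \<not> (\<forall>j \<in> elts a. t \<noteq> j)) \<and> (\<forall>j \<in> elts a. j \<in> elts b)"])
    show "definable ?K (\<lambda>s. \<exists>b \<in> M. vpair b (s 0) \<in> elts f \<and>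
        (\<forall>t \<in> elts b. \<not> (\<forall>j \<in> elts a. t \<noteq> j)) \<and> (\<forall>j \<in> elts a. j \<in> elts b))"
      using sub f(1) a(2)
      by (intro definable_ex definable_conj definable_vpair_mem definable_ball definable_not
          definable_finite_ball definable_mem definable_eq KM term_over_var term_over_param) auto
    show "vapp f a \<in> M" by (rule vpair_mem_M[OF fM app])
    show "\<exists>b \<in> M. vpair b (vapp f a) \<in> elts f \<and>
        (\<forall>t \<in> elts b. \<not> (\<forall>j \<in> elts a. t \<noteq> j)) \<and> (\<forall>j \<in> elts a. j \<in> elts b)"
      using vpair_mem_M[OF fM app] app by auto
    fix y assume "\<exists>b \<in> M. vpair b y \<in> elts f \<and>
        (\<forall>t \<in> elts b. \<not> (\<forall>j \<in> elts a. t \<noteq> j)) \<and> (\<forall>j \<in> elts a. j \<in> elts b)"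
    then obtain b where b: "vpair b y \<in> elts f" "elts b = elts a" by blast
    then have "vpair a y \<in> elts f" using extensionality by metis
    then show "y = vapp f a" using app f(2) a(1) unfolding vfun_def by blast
  qed
qed

text \<open>For nonempty \<open>a\<close>, the value lies in the hull of \<open>Z\<close> and
  \<open>a\<close> below some ordinal of \<open>Z\<close> that is less than \<open>lam\<close>, so
  end extension returns it to \<open>Z\<close>.\<close>

lemma generic_vapp:
  assumes Z: "def_closed Z" and a: "elts a \<subseteq> elts lam" "finite (elts a)"
    and gen: "\<And>c. c \<in> elts a \<Longrightarrow> generic c (hull (Z \<union> {d \<in> elts a. d \<in> elts c}))"
    and f: "f \<in> Z" "vfun f (n_subsets lam (card (elts a))) omega1"
  shows "vapp f a \<in> Z"
proof -
  note ZM = def_closed_subset[OF Z]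
  have fM: "f \<in> M" using f ZM by blast
  have an: "a \<in> n_subsets lam (card (elts a))" using a by (simp add: n_subsets_def)
  have h: "vapp f a \<in> hull (Z \<union> elts a)"
    by (rule vapp_in_hull[OF Z f an a(2)]) (use a(1) mem_lam_in_M in blast)
  show ?thesis
  proof (cases "elts a = {}")
    case True
    then show ?thesis using h hull_def_closed_eq[OF Z] by simp
  next
    case False
    \<comment> \<open>For positive arity, \<open>lam\<close> is the union of the domain of
      \<open>f\<close> and hence definable from \<open>f\<close>.\<close>
    have "lam \<in> Z"
    proof (rule def_closed_comprehension[OF Z, of "\<lambda>t. \<exists>b \<in> M. \<exists>y \<in> M. vpair b y \<in> elts f \<and> t \<in> elts b"])
      show "definable Z (\<lambda>s. \<exists>b \<in> M. \<exists>y \<in> M. vpair b y \<in> elts f \<and> s 0 \<in> elts b)"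
        by (intro definable_ex definable_conj definable_vpair_mem definable_mem ZM term_over_var term_over_param f)
      show "elts lam = {t \<in> M. \<exists>b \<in> M. \<exists>y \<in> M. vpair b y \<in> elts f \<and> t \<in> elts b}"
      proof (intro set_eqI iffI)
        fix t assume t: "t \<in> elts lam"
        have "infinite (elts lam - {t})" using infinite_lam by simp
        \<comment> \<open>\<open>t\<close> is padded with \<open>card (elts a) - 1\<close> further
          ordinals to an argument of \<open>f\<close>.\<close>
        then obtain B where B: "finite B" "card B = card (elts a) - 1" "B \<subseteq> elts lam - {t}"
          using infinite_arbitrarily_large by blast
        have eb: "elts (vset (insert t B)) = insert t B" using B t by (intro elts_vset_lam) auto
        have "card (elts a) > 0" using False a(2) by (simp add: card_gt_0_iff)
        then have "card (insert t B) = card (elts a)" using B by (subst card_insert_disjoint) auto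
        then have "vset (insert t B) \<in> n_subsets lam (card (elts a))"
          using B t eb by (auto simp: n_subsets_def)
        from vapp_eqI[OF f(2) this]
        show "t \<in> {t \<in> M. \<exists>b \<in> M. \<exists>y \<in> M. vpair b y \<in> elts f \<and> t \<in> elts b}"
          using vpair_mem_M[OF fM] mem_lam_in_M[OF t] eb by blast
      next
        fix t assume "t \<in> {t \<in> M. \<exists>b \<in> M. \<exists>y \<in> M. vpair b y \<in> elts f \<and> t \<in> elts b}"
        then show "t \<in> elts lam" using vfun_pairD(1)[OF f(2)] by (auto simp: n_subsets_def)
      qed
    qed (rule lam_in_M)
    obtain d0 where d0: "d0 \<in> elts lam" "uncountable (elts d0)"
      using measurable_cardinal_uncountable_mem[OF measurable] by blast
    \<comment> \<open>An uncountable ordinal lies above all countable ones, so \<open>d0\<close>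
      bounds the values of \<open>f\<close>.\<close>
    have "y \<in> elts d0" if "y \<in> omega1" for y
    proof -
      have y: "Ord y" "countable (elts y)" using that by (auto simp: omega1_def)
      show ?thesis
        using Ord_linear[OF y(1) Ord_mem[OF Ord_lam d0(1)]] y d0(2) Ord_subset[OF y(1), of d0] countable_subset
        by metis
    qed
    then have "d0 \<in> elts lam \<and> (\<forall>b \<in> M. \<forall>y \<in> M. vpair b y \<in> elts f \<longrightarrow> y \<in> elts d0)"
      using d0 vfun_pairD(2)[OF f(2)] by blast
    moreover have "definable Z (\<lambda>s. s 0 \<in> elts lam \<and> (\<forall>b \<in> M. \<forall>y \<in> M. vpair b y \<in> elts f \<longrightarrow> y \<in> elts (s 0)))"
      by (intro definable_all definable_conj definable_imp definable_vpair_mem definable_mem ZM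
          term_over_var term_over_param f \<open>lam \<in> Z\<close>)
    \<comment> \<open>\<open>d0\<close> may lie outside \<open>Z\<close>; definable closure yields a
      bound inside \<open>Z\<close>.\<close>
    ultimately obtain d where d: "d \<in> Z" "d \<in> elts lam"
        "\<forall>b \<in> M. \<forall>y \<in> M. vpair b y \<in> elts f \<longrightarrow> y \<in> elts d"
      using def_closed_witness[OF Z, of "\<lambda>d. d \<in> elts lam \<and> (\<forall>b \<in> M. \<forall>y \<in> M. vpair b y \<in> elts f \<longrightarrow> y \<in> elts d)" d0]
        mem_lam_in_M[OF d0(1)] by blast
    have "vapp f a \<in> elts d"
      using d(3) vapp_eqI[OF f(2) an] vpair_mem_M[OF fM] by blast
    with Z \<open>lam \<in> Z\<close> a(2) gen d(1,2) h show ?thesis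
      by (rule generic_finite_end_extension)
  qed
qed

text \<open>\<open>z\<close> is the range of one sequence generic over \<open>X\<close> together
  with all members of \<open>C\<close>; restricting genericity to smaller hulls gives the hypotheses
  of \<open>generic_vapp\<close> for each \<open>Z\<close> and of end extension for
  \<open>X\<close>.\<close>

lemma end_extension_exists:
  assumes \<beta>: "Ord \<beta>" "countable (elts \<beta>)" "elts \<beta> \<noteq> {}"
    and X: "countable X" "def_closed X" "lam \<in> X"
    and C: "countable C" "\<And>Z. Z \<in> C \<Longrightarrow> countable Z \<and> def_closed Z"
  shows "\<exists>z \<in> otype_subsets lam \<beta>.
    (\<forall>a \<in> fin_subsets z. \<forall>Z \<in> C. \<forall>f \<in> Z. vfun f (n_subsets lam (card (elts a))) omega1 \<longrightarrow> vapp f a \<in> Z) \<and>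
    proper_initial_segment (X \<inter> elts lam) (hull (X \<union> elts z) \<inter> elts lam)"
proof -
  define W where "W = X \<union> \<Union>C"
  have "countable (\<Union>Z \<in> C. Z)" using C by (intro countable_UN) auto
  then have "countable W" unfolding W_def using X(1) by simp
  from generic_sequence[OF this] obtain g :: "'v \<Rightarrow> 'v"
    where g: "\<forall>a. countable (elts a) \<longrightarrow> generic (g a) (hull (W \<union> g ` elts a))"
    by (rule exE)
  have gen: "generic (g a) (hull (W \<union> g ` elts a))" if "a \<in> elts \<beta>" for a
    using g countable_subset[OF Ord_subset[OF \<beta>(1) that] \<beta>(2)] by simp
  have gl: "g a \<in> elts lam" if "a \<in> elts \<beta>" for a
    using gen[OF that] by (simp add: generic_def)
  have "Z \<subseteq> M" if "Z \<in> C" for Z using C(2)[OF that] def_closed_subset by simp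
  then have WM: "W \<subseteq> M" unfolding W_def using def_closed_subset[OF X(2)] by (simp add: Sup_le_iff)
  have dc: "def_closed (hull (W \<union> g ` elts a))" if "a \<in> elts \<beta>" for a
  proof (rule hull_def_closed)
    show "W \<union> g ` elts a \<subseteq> M"
      using WM gl mem_lam_in_M Ord_subset[OF \<beta>(1) that] by blast
    show "W \<union> g ` elts a \<noteq> {}" using X(3) by (auto simp: W_def)
  qed
  have lamW: "lam \<in> hull (W \<union> g ` elts a)" for a
    by (rule Skolem_hull.base) (use X(3) W_def in blast)
  have mono: "g a \<in> elts (g b)" if "b \<in> elts \<beta>" "a \<in> elts b" for a b
  proof (rule generic_above[OF dc[OF that(1)] lamW gen[OF that(1)]])
    show "g a \<in> hull (W \<union> g ` elts b)" by (rule Skolem_hull.base) (use that in blast)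
    show "g a \<in> elts lam" using gl Ord_subset[OF \<beta>(1) that(1)] that(2) by blast
  qed
  have iff: "a \<in> elts b \<longleftrightarrow> g a \<in> elts (g b)" if "a \<in> elts \<beta>" "b \<in> elts \<beta>" for a b
    using Ord_linear[OF Ord_mem[OF \<beta>(1) that(1)] Ord_mem[OF \<beta>(1) that(2)]] mono that mem_asym mem_irrefl
    by metis
  have inj: "inj_on g (elts \<beta>)"
  proof (rule inj_onI)
    fix a b assume ab: "a \<in> elts \<beta>" "b \<in> elts \<beta>" "g a = g b"
    then show "a = b"
      using Ord_linear[OF Ord_mem[OF \<beta>(1) ab(1)] Ord_mem[OF \<beta>(1) ab(2)]] iff mem_irrefl by metis
  qed
  define z where "z = vset (g ` elts \<beta>)"
  have ez: "elts z = g ` elts \<beta>" unfolding z_def by (rule elts_vset_image)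
  have zl: "elts z \<subseteq> elts lam" using gl ez by auto
  have gen_sub: "generic c (hull (Z \<union> {d \<in> F. d \<in> elts c}))" if F: "F \<subseteq> elts z" "c \<in> F" and "Z \<subseteq> W" for c F Z
  proof -
    obtain a where a: "a \<in> elts \<beta>" "c = g a" using F ez by blast
    \<comment> \<open>An element of \<open>F\<close> below \<open>g a\<close> has an index below
      \<open>a\<close>, so it was available when \<open>g a\<close> was chosen.\<close>
    have "{d \<in> F. d \<in> elts c} \<subseteq> g ` elts a" using F iff a ez by auto
    then have "hull (Z \<union> {d \<in> F. d \<in> elts c}) \<subseteq> hull (W \<union> g ` elts a)"
      by (intro hull_mono) (use that(3) in blast)
    then show ?thesis using generic_antimono[OF gen[OF a(1)]] a(2) by simp
  qed
  show ?thesis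
  proof (intro bexI[of _ z] conjI ballI impI)
    show "z \<in> otype_subsets lam \<beta>"
      unfolding otype_subsets_def using zl iff inj ez by (auto simp: bij_betw_def intro!: exI[of _ g])
    fix a Z f
    assume a: "a \<in> fin_subsets z" and Z: "Z \<in> C" and f: "f \<in> Z" "vfun f (n_subsets lam (card (elts a))) omega1"
    show "vapp f a \<in> Z"
    proof (rule generic_vapp[OF _ _ _ _ f])
      show "def_closed Z" using C Z by blast
      show "elts a \<subseteq> elts lam" "finite (elts a)" using a zl by (auto simp: fin_subsets_def)
      fix c assume "c \<in> elts a"
      then show "generic c (hull (Z \<union> {d \<in> elts a. d \<in> elts c}))"
        by (intro gen_sub) (use a Z in \<open>auto simp: fin_subsets_def W_def\<close>)
    qed
  next
    let ?Y = "hull (X \<union> elts z)"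
    have XY: "X \<subseteq> ?Y" using hull_base[of "X \<union> elts z"] by blast
    have init: "y \<in> X" if x: "x \<in> X" "x \<in> elts lam" and y: "y \<in> ?Y" "y \<in> elts x" for x y
    proof -
      obtain F where F: "finite F" "F \<subseteq> elts z" "y \<in> hull (X \<union> F)" using hull_finitary[OF y(1)] by blast
      show ?thesis
        by (rule generic_finite_end_extension[OF X(2,3) F(1) gen_sub[OF F(2)] x F(3) y(2)])
           (auto simp: W_def)
    qed
    obtain b where b: "b \<in> elts \<beta>" using \<beta>(3) by blast
    \<comment> \<open>\<open>g b\<close> lies above every element of \<open>X\<close> below
      \<open>lam\<close>, so membership in \<open>X\<close> would put it above itself.\<close>
    have "g b \<notin> X"
    proof
      assume "g b \<in> X"
      then have "g b \<in> hull (W \<union> g ` elts b)" by (intro Skolem_hull.base) (simp add: W_def)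
      then show False using generic_above[OF dc[OF b] lamW gen[OF b] _ gl[OF b]] mem_irrefl by blast
    qed
    moreover have "g b \<in> ?Y" by (rule Skolem_hull.base) (use b ez in blast)
    ultimately have "X \<inter> elts lam \<subset> ?Y \<inter> elts lam" using XY gl[OF b] by blast
    then show "proper_initial_segment (X \<inter> elts lam) (?Y \<inter> elts lam)"
      unfolding proper_initial_segment_def using init by blast
  qed
qed

end

theorem theorem5p1:
  fixes lam \<theta> :: "'v::zfc_universe" and R :: "('v \<times> 'v) set"
  assumes "measurable_cardinal lam"
    and "regular_cardinal \<theta>"
    and "V_stage (ord_succ (ord_succ lam)) \<subseteq> H \<theta>"
    and "well_order_on (H \<theta>) R"
  shows "\<forall>\<beta> X :: 'v. Ord \<beta> \<and> countable (elts \<beta>) \<and> elts \<beta> \<noteq> {} \<and>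
           countable (elts X) \<and> elem_submodel (elts X) (H \<theta>) R \<and> lam \<in> elts X \<longrightarrow>
           (\<exists>z \<in> otype_subsets lam \<beta>.
              fin_subsets z \<subseteq>
                \<Inter> {D_set lam Z | Z. countable (elts Z) \<and> elem_submodel (elts Z) (H \<theta>) R \<and> Z \<in> elts X} \<and>
              (let Y = Skolem_hull (H \<theta>) R (elts X \<union> elts z)
               in proper_initial_segment (elts X \<inter> elts lam) (Y \<inter> elts lam)))"
proof (intro allI impI, elim conjE)
  interpret measurable_structure "H \<theta>" R lam
    by unfold_locales (use assms H_transitive in auto)
  fix \<beta> X :: 'v
  assume \<beta>: "Ord \<beta>" "countable (elts \<beta>)" "elts \<beta> \<noteq> {}"
    and X: "countable (elts X)" "elem_submodel (elts X) (H \<theta>) R" "lam \<in> elts X"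
  let ?C = "elts ` {Z \<in> elts X. countable (elts Z) \<and> elem_submodel (elts Z) (H \<theta>) R}"
  have "\<exists>z \<in> otype_subsets lam \<beta>.
    (\<forall>a \<in> fin_subsets z. \<forall>Z \<in> ?C. \<forall>f \<in> Z. vfun f (n_subsets lam (card (elts a))) omega1 \<longrightarrow> vapp f a \<in> Z) \<and>
    proper_initial_segment (elts X \<inter> elts lam) (hull (elts X \<union> elts z) \<inter> elts lam)"
  proof (rule end_extension_exists[OF \<beta> X(1) elem_submodel_def_closed[OF X(2)] X(3)])
    have "countable {Z \<in> elts X. countable (elts Z) \<and> elem_submodel (elts Z) (H \<theta>) R}"
      by (rule countable_subset[OF _ X(1)]) blast
    then show "countable ?C" by (rule countable_image)
  qed (auto intro: elem_submodel_def_closed)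
  then obtain z where z: "z \<in> otype_subsets lam \<beta>"
    and D: "\<forall>a \<in> fin_subsets z. \<forall>Z \<in> ?C. \<forall>f \<in> Z.
      vfun f (n_subsets lam (card (elts a))) omega1 \<longrightarrow> vapp f a \<in> Z"
    and init: "proper_initial_segment (elts X \<inter> elts lam) (hull (elts X \<union> elts z) \<inter> elts lam)"
    by (elim bexE conjE) (rule that)
  have zl: "elts z \<subseteq> elts lam" using z by (simp add: otype_subsets_def)
  have "a \<in> D_set lam Z"
    if "a \<in> fin_subsets z" "countable (elts Z)" "elem_submodel (elts Z) (H \<theta>) R" "Z \<in> elts X" for a Z
    unfolding D_set_def using D that zl by (auto simp: fin_subsets_def)
  then have "fin_subsets z \<subseteq>
      \<Inter> {D_set lam Z | Z. countable (elts Z) \<and> elem_submodel (elts Z) (H \<theta>) R \<and> Z \<in> elts X}"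
    by blast
  with z init show "\<exists>z \<in> otype_subsets lam \<beta>.
      fin_subsets z \<subseteq>
        \<Inter> {D_set lam Z | Z. countable (elts Z) \<and> elem_submodel (elts Z) (H \<theta>) R \<and> Z \<in> elts X} \<and>
      (let Y = hull (elts X \<union> elts z)
       in proper_initial_segment (elts X \<inter> elts lam) (Y \<inter> elts lam))"
    unfolding Let_def by blast
qed

end
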